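(* For every $n\ge 1$, $$\dim(\overline{\mathcal{C}}_n)=\dim(\mathcal{C}_n)=\binom{2n}{n}-2n,$$ where $\mathcal{C}_n$ is the cone of bounded ratios and $\overline{\mathcal{C}}_n$ is the cone generated by the vectors of primitive ratios. (The dimension of a cone is the dimension of its linear span.)
   Context: A real $n\times n$ matrix is totally positive if all its minors are positive. For $I,I'\subseteq\{1,\dots,n\}$ with $|I|=|I'|$, $\Delta_{I,I'}(X)$ is the minor of $X$ with row set $I$ and column set $I'$, and $\Delta_{\emptyset,\emptyset}(X)=1$. Plücker notation: for an $n$-element subset $K\subseteq\{1,\dots,2n\}$ put $[K]=\Delta_K(X):=\Delta_{I,I'}(X)$ with $I=K\cap\{1,\dots,n\}$ and $I'=\{1,\dots,n\}\setminus\{2n+1-k : k\in K,\ k\ge n+1\}$. (This is a maximal minor of the $2n\times n$ matrix obtained by stacking $X$ on top of $W_0=((-1)^{i+1}\delta_{j,n-i+1})_{i,j=1}^n$.) The map $K\mapsto(I,I')$ is a bijection between $n$-subsets of $\{1,\dots,2n\}$ and pairs $(I,I')$ with $|I|=|I'|$. A ratio is a Laurent monomial $R=\prod_K \Delta_K^{\alpha_K}$, with $\alpha_K\in\mathbb{Z}$, over the $N=\binom{2n}{n}$ Plücker coordinates, with $\sum_K\alpha_K=0$ (so that $R$ is a well-defined function on the Grassmannian; factors $\Delta_{\emptyset,\emptyset}=1$ may be used to balance the degrees). It is bounded if there is a constant $C$ with $R(X)\le C$ for all totally positive $n\times n$ matrices $X$. $V_n=\mathbb{R}^{N}$ has a coordinate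 for each Plücker coordinate, and $R$ corresponds to the vector $(\alpha_K)_K\in V_n$. $\mathcal{C}_n\subseteq V_n$ is the cone formed by the bounded ratios, i.e. the convex cone generated by the vectors corresponding to bounded ratios. A primitive ratio is $$R_{i,j,\Delta}=\frac{[\{i,j+1\}\cup\Delta]\,[\{i+1,j\}\cup\Delta]}{[\{i,j\}\cup\Delta]\,[\{i+1,j+1\}\cup\Delta]},$$ where $i,j\in\{1,\dots,2n\}$, $i<j$, $\Delta\subset\{1,\dots,2n\}$, $|\Delta|=n-2$, the index $j+1$ is understood mod $2n$, and $i,i+1,j,j+1$ and the elements of $\Delta$ are all distinct. Its vector in $V_n$ is denoted $\vec v_{i,j,\Delta}$ and called a primitive vector. $\overline{\mathcal{C}}_n$ is the convex cone in $V_n$ generated by all primitive vectors (for $n=1$ there are none and $\overline{\mathcal{C}}_1=\{0\}$). *)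

theory Defs
  imports
    "HOL-Analysis.Analysis"
    "HOL-Analysis.Finite_Function_Topology"
    "Jordan_Normal_Form.Determinant"
    "Jordan_Normal_Form.DL_Submatrix"
begin

text \<open>
  Row and column sets are subsets of \<open>{1..n}\<close>, whereas the entries of a matrix are indexed
  from 0; the preimage under \<^const>\<open>Suc\<close> makes the shift.
\<close>

definition minor :: "real mat \<Rightarrow> nat set \<Rightarrow> nat set \<Rightarrow> real" where
  "minor X I J = Determinant.det (submatrix X (Suc -` I) (Suc -` J))"

definition totally_positive :: "nat \<Rightarrow> real mat \<Rightarrow> bool" where
  "totally_positive n X \<longleftrightarrow> X \<in> carrier_mat n n \<and>
     (\<forall>I J. I \<subseteq> {1..n} \<and> J \<subseteq> {1..n} \<and> card I = card J \<longrightarrow> minor X I J > 0)"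

definition plucker_indices :: "nat \<Rightarrow> nat set set" where
  "plucker_indices n = {K. K \<subseteq> {1..2 * n} \<and> card K = n}"

definition plucker :: "nat \<Rightarrow> real mat \<Rightarrow> nat set \<Rightarrow> real" where
  "plucker n X K =
     minor X (K \<inter> {1..n}) ({1..n} - (\<lambda>k. 2 * n + 1 - k) ` {k \<in> K. k \<ge> n + 1})"

text \<open>
  A ratio is represented by its exponents. The space \<open>V\<^sub>n\<close> is the subspace
  of \<open>nat set \<Rightarrow>\<^sub>0 real\<close> of the vectors whose keys lie in \<^term>\<open>plucker_indices n\<close>.
\<close>

definition is_ratio :: "nat \<Rightarrow> (nat set \<Rightarrow>\<^sub>0 int) \<Rightarrow> bool" where
  "is_ratio n \<alpha> \<longleftrightarrow> Poly_Mapping.keys \<alpha> \<subseteq> plucker_indices n \<and>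
     (\<Sum>K\<in>plucker_indices n. Poly_Mapping.lookup \<alpha> K) = 0"

definition ratio_value :: "nat \<Rightarrow> (nat set \<Rightarrow>\<^sub>0 int) \<Rightarrow> real mat \<Rightarrow> real" where
  "ratio_value n \<alpha> X =
     (\<Prod>K\<in>plucker_indices n. plucker n X K powi Poly_Mapping.lookup \<alpha> K)"

definition bounded_ratio :: "nat \<Rightarrow> (nat set \<Rightarrow>\<^sub>0 int) \<Rightarrow> bool" where
  "bounded_ratio n \<alpha> \<longleftrightarrow> is_ratio n \<alpha> \<and>
     (\<exists>C. \<forall>X. totally_positive n X \<longrightarrow> ratio_value n \<alpha> X \<le> C)"

definition ratio_vector :: "(nat set \<Rightarrow>\<^sub>0 int) \<Rightarrow> (nat set \<Rightarrow>\<^sub>0 real)" where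
  "ratio_vector \<alpha> = Poly_Mapping.map real_of_int \<alpha>"

definition bounded_cone :: "nat \<Rightarrow> (nat set \<Rightarrow>\<^sub>0 real) set" where
  "bounded_cone n = convex_cone hull (ratio_vector ` {\<alpha>. bounded_ratio n \<alpha>})"

definition cyclic_succ :: "nat \<Rightarrow> nat \<Rightarrow> nat" where
  "cyclic_succ n j = (if j = 2 * n then 1 else j + 1)"

definition primitive_index :: "nat \<Rightarrow> nat \<Rightarrow> nat \<Rightarrow> nat set \<Rightarrow> bool" where
  "primitive_index n i j D \<longleftrightarrow>
     i \<in> {1..2 * n} \<and> j \<in> {1..2 * n} \<and> i < j \<and> D \<subseteq> {1..2 * n} \<and> card D + 2 = n \<and>
     distinct [i, i + 1, j, cyclic_succ n j] \<and> {i, i + 1, j, cyclic_succ n j} \<inter> D = {}"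

definition primitive_ratio :: "nat \<Rightarrow> nat \<Rightarrow> nat \<Rightarrow> nat set \<Rightarrow> (nat set \<Rightarrow>\<^sub>0 int)" where
  "primitive_ratio n i j D =
     Poly_Mapping.single ({i, cyclic_succ n j} \<union> D) 1 + Poly_Mapping.single ({i + 1, j} \<union> D) 1
     - Poly_Mapping.single ({i, j} \<union> D) 1
     - Poly_Mapping.single ({i + 1, cyclic_succ n j} \<union> D) 1"

definition primitive_cone :: "nat \<Rightarrow> (nat set \<Rightarrow>\<^sub>0 real) set" where
  "primitive_cone n =
     convex_cone hull {ratio_vector (primitive_ratio n i j D) | i j D. primitive_index n i j D}"

end

theory Submission
  imports Defs
begin

text \<open>
  Write \<open>e\<^sub>K\<close> for the unit vectors of \<open>V\<^sub>n\<close>. Modulo the primitive vectors, the difference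
  \<open>e\<^bsub>A \<union> {i + 1}\<^esub> - e\<^bsub>A \<union> {i}\<^esub>\<close> depends only on \<open>i\<close>, because the other elements can be moved
  one step at a time around the cycle. Hence \<open>2n\<close> further vectors (one difference for each
  \<open>i < 2n\<close> and one \<open>e\<^sub>K\<close>) suffice to span \<open>V\<^sub>n\<close>, and the primitive vectors span at least
  \<open>N - 2n\<close> dimensions.

  Conversely, the Pluecker coordinates are the maximal minors of a \<open>2n \<times> n\<close> matrix, and scaling its
  \<open>k\<close>-th row by \<open>t\<close> preserves total positivity and multiplies a ratio by a power of \<open>t\<close>. For a bounded
  ratio that power vanishes, so the sum of \<open>\<alpha>\<^sub>K\<close> over the \<open>K\<close> containing \<open>k\<close> is zero for every \<open>k\<close>.
  These \<open>2n\<close> conditions are independent. They restrict the bounded ratios only because a totally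
  positive matrix exists; a Cauchy matrix is one.

  Primitive ratios are bounded by 1, by the three-term Pluecker relation, all of whose terms are
  positive. So both cones have dimension \<open>N - 2n\<close>.
\<close>

section \<open>The span of the primitive vectors\<close>

abbreviation unit_vector :: "nat set \<Rightarrow> (nat set \<Rightarrow>\<^sub>0 real)" where
  "unit_vector K \<equiv> Poly_Mapping.single K 1"

lemma lookup_scaleR:
  fixes v :: "'a \<Rightarrow>\<^sub>0 'b::real_vector"
  shows "Poly_Mapping.lookup (r *\<^sub>R v) k = r *\<^sub>R Poly_Mapping.lookup v k"
proof -
  have "finite {k. r *\<^sub>R Poly_Mapping.lookup v k \<noteq> 0}"
    by (rule finite_subset[of _ "Poly_Mapping.keys v"]) (auto simp: in_keys_iff)
  then show ?thesis by (simp add: scaleR_poly_mapping_def)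
qed

lemma finite_plucker_indices [simp]: "finite (plucker_indices n)"
  by (simp add: plucker_indices_def)

lemma card_plucker_indices: "card (plucker_indices n) = (2 * n) choose n"
  using n_subsets[of "{1..2 * n}" n] by (simp add: plucker_indices_def)

lemma poly_mapping_sum_single:
  assumes "finite A" "Poly_Mapping.keys v \<subseteq> A"
  shows "(\<Sum>k\<in>A. Poly_Mapping.lookup v k *\<^sub>R Poly_Mapping.single k (1::real)) = v"
proof (rule poly_mapping_eqI)
  fix k
  have "Poly_Mapping.lookup (\<Sum>k\<in>A. Poly_Mapping.lookup v k *\<^sub>R Poly_Mapping.single k (1::real)) k
      = (\<Sum>k'\<in>A. if k' = k then Poly_Mapping.lookup v k' else 0)"
    unfolding lookup_sum by (rule sum.cong) (auto simp: lookup_scaleR lookup_single when_def)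
  also have "\<dots> = Poly_Mapping.lookup v k"
    using assms by (auto simp: sum.delta in_keys_iff)
  finally show "Poly_Mapping.lookup (\<Sum>k\<in>A. Poly_Mapping.lookup v k *\<^sub>R Poly_Mapping.single k (1::real)) k
      = Poly_Mapping.lookup v k" .
qed

lemma in_span_single:
  assumes "finite A" "Poly_Mapping.keys v \<subseteq> A"
  shows "v \<in> span ((\<lambda>k. Poly_Mapping.single k (1::real)) ` A)"
  by (subst poly_mapping_sum_single[OF assms, symmetric])
    (intro span_sum span_scale span_base imageI)

lemma inj_single: "inj (\<lambda>k. Poly_Mapping.single k (1::real))"
  by (rule injI) (metis lookup_single_eq lookup_single_not_eq zero_neq_one)

lemma linear_lookup: "linear (\<lambda>v :: 'a \<Rightarrow>\<^sub>0 real. Poly_Mapping.lookup v k)"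
  by (rule linearI) (simp_all add: lookup_add lookup_scaleR)

lemma linear_zero_on_span:
  assumes "linear f" "\<And>x. x \<in> S \<Longrightarrow> f x = 0" "v \<in> span S"
  shows "f v = 0"
  using linear_eq_on[OF assms(1) linear_zero assms(3)] assms(2) by auto

text \<open>Coordinate \<open>k\<close> is 1 at the unit vector of \<open>k\<close> and vanishes on
  the span of the others.\<close>

lemma independent_single: "independent ((\<lambda>k. Poly_Mapping.single k (1::real)) ` A)"
proof
  assume "dependent ((\<lambda>k. Poly_Mapping.single k (1::real)) ` A)"
  then obtain k where k: "k \<in> A"
    and *: "Poly_Mapping.single k (1::real) \<in> span ((\<lambda>k. Poly_Mapping.single k 1) ` A - {Poly_Mapping.single k 1})"
    by (auto simp: dependent_def)
  have "Poly_Mapping.lookup (Poly_Mapping.single k (1::real)) k = 0"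
    by (rule linear_zero_on_span[OF linear_lookup _ *]) (auto simp: lookup_single when_def)
  then show False by simp
qed

text \<open>The functional \<open>\<phi> k\<close> vanishes on \<open>B\<close> and on all earlier
  \<open>u j\<close>, hence on their span, but not at \<open>u k\<close>. So the \<open>u k\<close>
  can be adjoined one after another, each outside the span reached so far; this also keeps them
  distinct and outside \<open>B\<close>, whence the exact count.\<close>

lemma independent_Un_triangular:
  fixes u :: "nat \<Rightarrow> 'v::real_vector" and \<phi> :: "nat \<Rightarrow> 'v \<Rightarrow> real"
  assumes "independent B" "finite B"
    and "\<And>k. k < m \<Longrightarrow> linear (\<phi> k)"
    and "\<And>k b. k < m \<Longrightarrow> b \<in> B \<Longrightarrow> \<phi> k b = 0"
    and "\<And>j k. j < k \<Longrightarrow> k < m \<Longrightarrow> \<phi> k (u j) = 0"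
    and "\<And>k. k < m \<Longrightarrow> \<phi> k (u k) \<noteq> 0"
  shows "independent (B \<union> u ` {..<m}) \<and> card (B \<union> u ` {..<m}) = card B + m"
  using assms(3-)
proof (induction m)
  case 0
  then show ?case using assms by simp
next
  case (Suc m)
  let ?S = "B \<union> u ` {..<m}"
  have "u m \<notin> span ?S"
  proof
    assume "u m \<in> span ?S"
    then have "\<phi> m (u m) = 0"
      by (rule linear_zero_on_span[rotated 2]) (use Suc.prems in auto)
    then show False using Suc.prems(4) by blast
  qed
  moreover from this have "u m \<notin> ?S" by (meson span_base)
  moreover have "independent ?S \<and> card ?S = card B + m"
    by (rule Suc.IH) (use Suc.prems in auto)
  moreover have "B \<union> u ` {..<Suc m} = insert (u m) ?S" by (auto simp: lessThan_Suc)
  ultimately show ?case using assms(2) by (simp add: independent_insert)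
qed

text \<open>For the vector of a ratio this is the exponent of \<open>t\<close> that the ratio
  acquires when row \<open>j\<close> of the stacked matrix is scaled by \<open>t\<close>.\<close>

definition incidence :: "nat \<Rightarrow> nat \<Rightarrow> (nat set \<Rightarrow>\<^sub>0 real) \<Rightarrow> real" where
  "incidence n j v = (\<Sum>K\<in>{K \<in> plucker_indices n. j \<in> K}. Poly_Mapping.lookup v K)"

lemma linear_incidence: "linear (incidence n j)"
  unfolding incidence_def by (intro linear_compose_sum ballI linear_lookup)

lemma incidence_unit_vector:
  "K \<in> plucker_indices n \<Longrightarrow> incidence n j (unit_vector K) = of_bool (j \<in> K)"
  by (auto simp: incidence_def lookup_single when_def sum.delta)

text \<open>Tokens slide along a path. Moving a token to a free place just below lowers the sum of
  the positions; a set that admits no such move is closed under predecessors, hence an initial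
  segment. \<open>F\<close> and \<open>T\<close> stay general because the lemma serves twice: for
  differences of unit vectors on the cut cycle, and for the unit vectors themselves on
  \<open>{1..2 * n}\<close>.\<close>

lemma adjacent_moves_connected:
  fixes F :: "nat set \<Rightarrow> 'v::real_vector"
  assumes T: "subspace T"
    and move: "\<And>B p. \<lbrakk>B \<subseteq> {..<m}; p \<notin> B; Suc p \<notin> B; Suc p < m; Suc (card B) = k\<rbrakk>
        \<Longrightarrow> F (insert (Suc p) B) - F (insert p B) \<in> T"
    and A: "A \<subseteq> {..<m}" "card A = k"
  shows "F A - F {..<k} \<in> T"
  using A
proof (induction "\<Sum>A" arbitrary: A rule: less_induct)
  case less
  have fin: "finite A" using less.prems finite_subset by blast
  show ?case
  proof (cases "\<forall>p. Suc p \<in> A \<longrightarrow> p \<in> A")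
    case True
    have down: "q \<in> A" if "p \<in> A" "q \<le> p" for p q
      using that(2,1) by (induction p rule: dec_induct) (use True in auto)
    have "A = {..<k}"
    proof (rule card_subset_eq[symmetric])
      show "{..<k} \<subseteq> A"
      proof (rule ccontr)
        assume "\<not> {..<k} \<subseteq> A"
        then obtain q where q: "q < k" "q \<notin> A" by auto
        then have "A \<subseteq> {..<q}" using down by (metis lessThan_iff not_le subsetI)
        then have "card A \<le> q" using card_mono[of "{..<q}" A] by simp
        then show False using q less.prems by simp
      qed
    qed (use fin less.prems in auto)
    then show ?thesis using T by (simp add: subspace_0)
  next
    case False
    then obtain p where p: "Suc p \<in> A" "p \<notin> A" by auto
    define B where "B = A - {Suc p}"
    have AB: "A = insert (Suc p) B" and pB: "p \<notin> B" "Suc p \<notin> B" "finite B"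
      using p fin by (auto simp: B_def)
    have 1: "F A - F (insert p B) \<in> T"
      unfolding AB by (rule move) (use less.prems AB pB in auto)
    have 2: "F (insert p B) - F {..<k} \<in> T"
      by (rule less.hyps) (use less.prems AB pB in auto)
    show ?thesis using subspace_add[OF T 1 2] by simp
  qed
qed

section \<open>Primitive vectors and the effect of moving one element\<close>

abbreviation primitive_vectors :: "nat \<Rightarrow> (nat set \<Rightarrow>\<^sub>0 real) set" where
  "primitive_vectors n \<equiv>
     {ratio_vector (primitive_ratio n i j D) | i j D. primitive_index n i j D}"

lemma lookup_ratio_vector:
  "Poly_Mapping.lookup (ratio_vector \<alpha>) K = real_of_int (Poly_Mapping.lookup \<alpha> K)"
  by (simp add: ratio_vector_def Poly_Mapping.map.rep_eq when_def)

lemma ratio_vector_add: "ratio_vector (\<alpha> + \<beta>) = ratio_vector \<alpha> + ratio_vector \<beta>"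
  and ratio_vector_diff: "ratio_vector (\<alpha> - \<beta>) = ratio_vector \<alpha> - ratio_vector \<beta>"
  by (rule poly_mapping_eqI, simp add: lookup_ratio_vector lookup_add lookup_minus)+

lemma ratio_vector_single: "ratio_vector (Poly_Mapping.single K 1) = unit_vector K"
  by (rule poly_mapping_eqI) (simp add: lookup_ratio_vector lookup_single when_def)

lemma ratio_vector_primitive:
  "ratio_vector (primitive_ratio n i j D) =
     unit_vector ({i, cyclic_succ n j} \<union> D) + unit_vector ({i + 1, j} \<union> D)
     - unit_vector ({i, j} \<union> D) - unit_vector ({i + 1, cyclic_succ n j} \<union> D)"
  by (simp only: primitive_ratio_def ratio_vector_add ratio_vector_diff ratio_vector_single)

text \<open>The elements other than \<open>i\<close> and \<open>i + 1\<close> lie on the path that remains of the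
  cycle when \<open>i\<close> and \<open>i + 1\<close> are removed; moving one of them along an edge of that path changes
  the difference by a primitive vector.\<close>

lemma move_independent:
  assumes i: "i \<in> {1..<2 * n}"
    and A: "A \<subseteq> {1..2 * n} - {i, i + 1}" "card A = n - 1"
    and A': "A' \<subseteq> {1..2 * n} - {i, i + 1}" "card A' = n - 1"
  shows "(unit_vector (insert (i + 1) A) - unit_vector (insert i A))
      - (unit_vector (insert (i + 1) A') - unit_vector (insert i A')) \<in> span (primitive_vectors n)"
proof -
  \<comment> \<open>\<open>q\<close> runs through the path i + 2, ..., 2n, 1, ..., i - 1 in cyclic
    order.\<close>
  define q where "q p = (if i + 2 + p \<le> 2 * n then i + 2 + p else i + 2 + p - 2 * n)" for p
  define F where "F A = unit_vector (insert (i + 1) (q ` A)) - unit_vector (insert i (q ` A))" for A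
  let ?T = "span (primitive_vectors n)"
  have q_inj: "inj_on q {..<2 * n - 2}"
    by (rule inj_onI) (auto simp: q_def split: if_splits)
  have q_img: "q ` {..<2 * n - 2} = {1..2 * n} - {i, i + 1}"
  proof (rule card_subset_eq)
    show "q ` {..<2 * n - 2} \<subseteq> {1..2 * n} - {i, i + 1}"
      using i by (auto simp: q_def)
    have "card ({1..2 * n} - {i, i + 1}) = 2 * n - 2"
      using i by (subst card_Diff_subset) auto
    then show "card (q ` {..<2 * n - 2}) = card ({1..2 * n} - {i, i + 1})"
      by (simp add: card_image q_inj)
  qed auto
  have q_succ: "q (Suc p) = cyclic_succ n (q p)" if "Suc p < 2 * n - 2" for p
    using that i by (auto simp: q_def cyclic_succ_def)
  have move: "F (insert (Suc p) B) - F (insert p B) \<in> ?T"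
    if B: "B \<subseteq> {..<2 * n - 2}" "p \<notin> B" "Suc p \<notin> B" "Suc p < 2 * n - 2" "Suc (card B) = n - 1" for B p
  proof -
    let ?D = "q ` B"
    have cD: "card ?D + 2 = n"
      using B q_inj by (simp add: card_image inj_on_subset)
    have D: "?D \<subseteq> {1..2 * n} - {i, i + 1}"
      using q_img image_mono[OF B(1), of q] by simp
    have mem: "q p \<in> {1..2 * n} - {i, i + 1}" "q (Suc p) \<in> {1..2 * n} - {i, i + 1}"
      unfolding q_img[symmetric] by (rule imageI, use B(4) in simp)+
    have nD: "q p \<notin> ?D" "q (Suc p) \<notin> ?D"
      using inj_on_image_mem_iff[OF q_inj _ B(1)] B(2-4) by simp_all
    have neq: "q p \<noteq> q (Suc p)"
      using inj_onD[OF q_inj, of p "Suc p"] B(4) by auto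
    have F: "F (insert (Suc p) B) - F (insert p B) =
      - (unit_vector ({i, q (Suc p)} \<union> ?D) + unit_vector ({i + 1, q p} \<union> ?D)
     - unit_vector ({i, q p} \<union> ?D) - unit_vector ({i + 1, q (Suc p)} \<union> ?D))"
      by (simp add: F_def algebra_simps)
    have "unit_vector ({i, q (Suc p)} \<union> ?D) + unit_vector ({i + 1, q p} \<union> ?D)
     - unit_vector ({i, q p} \<union> ?D) - unit_vector ({i + 1, q (Suc p)} \<union> ?D) \<in> ?T"
    \<comment> \<open>The primitive vector is symmetric in the edges starting at \<open>i\<close>
      and at \<open>q p\<close>, but its index lists the smaller start first. The edge from 2n to 1
      occurs only in the first case, since \<open>i < 2 * n\<close>.\<close>
    proof (cases "i < q p")
      case True
      then have "primitive_index n i (q p) ?D"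
        using i mem nD neq cD D unfolding primitive_index_def q_succ[OF B(4), symmetric] by auto
      then show ?thesis
        using ratio_vector_primitive[of n i "q p" ?D] q_succ[OF B(4)] by (intro span_base) force
    next
      case False
      then have lt: "q p < i" using mem by force
      then have s: "q (Suc p) = q p + 1" and t: "cyclic_succ n i = i + 1"
        using i q_succ[OF B(4)] by (auto simp: cyclic_succ_def)
      have "primitive_index n (q p) i ?D"
        using i mem nD neq cD D lt unfolding primitive_index_def s[symmetric] t by auto
      moreover have "ratio_vector (primitive_ratio n (q p) i ?D) =
        unit_vector ({i, q (Suc p)} \<union> ?D) + unit_vector ({i + 1, q p} \<union> ?D)
         - unit_vector ({i, q p} \<union> ?D) - unit_vector ({i + 1, q (Suc p)} \<union> ?D)"
        unfolding ratio_vector_primitive t s by (simp add: insert_commute)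
      ultimately show ?thesis by (intro span_base) force
    qed
    then show ?thesis unfolding F by (rule span_neg)
  qed
  have conn: "F C - F {..<n - 1} \<in> ?T" if "C \<subseteq> {..<2 * n - 2}" "card C = n - 1" for C
    by (rule adjacent_moves_connected[where F = F, OF subspace_span move that])
  have *: "(unit_vector (insert (i + 1) A) - unit_vector (insert i A)) - F {..<n - 1} \<in> ?T"
    if "A \<subseteq> {1..2 * n} - {i, i + 1}" "card A = n - 1" for A
  proof -
    from that(1) obtain C where C: "C \<subseteq> {..<2 * n - 2}" "A = q ` C"
      unfolding q_img[symmetric] subset_image_iff by metis
    then have "card C = n - 1"
      using that(2) inj_on_subset[OF q_inj C(1)] by (simp add: card_image)
    from conn[OF C(1) this] show ?thesis unfolding C(2) F_def[of C] .
  qed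
  show ?thesis
    using span_diff[OF *[OF A] *[OF A']] by (simp add: algebra_simps)
qed

text \<open>For \<open>i\<close> in \<open>{1..<2 * n}\<close> the choice of \<open>A\<close> is
  immaterial modulo the primitive vectors, by \<open>move_independent\<close>; \<open>SOME\<close>
  fixes one representative.\<close>

definition move_vector :: "nat \<Rightarrow> nat \<Rightarrow> (nat set \<Rightarrow>\<^sub>0 real)" where
  "move_vector n i =
     (let A = (SOME A. A \<subseteq> {1..2 * n} - {i, i + 1} \<and> card A = n - 1)
      in unit_vector (insert (i + 1) A) - unit_vector (insert i A))"

lemma move_vectorE:
  assumes "i \<in> {1..<2 * n}"
  obtains A where "A \<subseteq> {1..2 * n} - {i, i + 1}" "card A = n - 1"
    "move_vector n i = unit_vector (insert (i + 1) A) - unit_vector (insert i A)"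
proof -
  have "card ({1..2 * n} - {i, i + 1}) = 2 * n - 2"
    using assms by (subst card_Diff_subset) auto
  then have "n - 1 \<le> card ({1..2 * n} - {i, i + 1})" by simp
  then have "\<exists>A. A \<subseteq> {1..2 * n} - {i, i + 1} \<and> card A = n - 1"
    by (meson obtain_subset_with_card_n)
  from someI_ex[OF this] show ?thesis
    using that unfolding move_vector_def Let_def by blast
qed

lemma insert_in_plucker_indices:
  assumes "A \<subseteq> {1..2 * n} - {i}" "card A = n - 1" "i \<in> {1..2 * n}"
  shows "insert i A \<in> plucker_indices n"
proof -
  have "finite A" "i \<notin> A" "n \<noteq> 0" using assms finite_subset by auto
  then show ?thesis using assms by (auto simp: plucker_indices_def)
qed

lemma incidence_move_vector:
  assumes "i \<in> {1..<2 * n}"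
  shows "incidence n j (move_vector n i) = of_bool (j = i + 1) - of_bool (j = i)"
proof -
  obtain A where A: "A \<subseteq> {1..2 * n} - {i, i + 1}" "card A = n - 1"
    "move_vector n i = unit_vector (insert (i + 1) A) - unit_vector (insert i A)"
    using move_vectorE[OF assms] .
  have P: "insert (i + 1) A \<in> plucker_indices n" "insert i A \<in> plucker_indices n"
    by (rule insert_in_plucker_indices; use A assms in auto)+
  show ?thesis
    unfolding A(3) linear_diff[OF linear_incidence] P[THEN incidence_unit_vector]
    using A(1) by (auto simp: of_bool_def)
qed

text \<open>The index is shifted to run over \<open>{..<2 * n}\<close>: first the 2n - 1 moves from
  \<open>k + 1\<close> to \<open>k + 2\<close>, last a unit vector, the only one whose coordinate
  sum is not zero.\<close>

definition complement_vector :: "nat \<Rightarrow> nat \<Rightarrow> (nat set \<Rightarrow>\<^sub>0 real)" where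
  "complement_vector n k =
     (if k < 2 * n - 1 then move_vector n (k + 1) else unit_vector {1..n})"

lemma initial_in_plucker_indices [simp]: "{1..n} \<in> plucker_indices n"
  by (auto simp: plucker_indices_def)

lemma complement_vector_in_span:
  assumes "n \<ge> 1"
  shows "complement_vector n k \<in> span (unit_vector ` plucker_indices n)"
proof (cases "k < 2 * n - 1")
  case True
  then have k: "k + 1 \<in> {1..<2 * n}" by auto
  obtain A where A: "A \<subseteq> {1..2 * n} - {k + 1, k + 1 + 1}" "card A = n - 1"
    "move_vector n (k + 1) = unit_vector (insert (k + 1 + 1) A) - unit_vector (insert (k + 1) A)"
    using move_vectorE[OF k] .
  have "insert (k + 1 + 1) A \<in> plucker_indices n" "insert (k + 1) A \<in> plucker_indices n"
    by (rule insert_in_plucker_indices; use A k in auto)+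
  then have "move_vector n (k + 1) \<in> span (unit_vector ` plucker_indices n)"
    unfolding A(3) by (intro span_diff span_base imageI)
  then show ?thesis
    using True by (simp add: complement_vector_def)
next
  case False
  then show ?thesis
    by (simp add: complement_vector_def span_base imageI del: One_nat_def)
qed

text \<open>Every \<open>K\<close> is reached from \<open>{1..n}\<close> by moves of one element
  along 1, ..., 2n, and each move adds or subtracts a \<open>move_vector\<close> modulo the
  primitive vectors.\<close>

lemma unit_vectors_in_span:
  assumes n: "n \<ge> 1" and K: "K \<in> plucker_indices n"
  shows "unit_vector K \<in> span (primitive_vectors n \<union> complement_vector n ` {..<2 * n})"
    (is "_ \<in> ?T")
proof -
  \<comment> \<open>\<open>adjacent_moves_connected\<close> counts positions from 0, the elements of
    \<open>K\<close> count from 1.\<close>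
  define F where "F A = unit_vector (Suc ` A)" for A
  have move: "F (insert (Suc p) B) - F (insert p B) \<in> ?T"
    if B: "B \<subseteq> {..<2 * n}" "p \<notin> B" "Suc p \<notin> B" "Suc p < 2 * n" "Suc (card B) = n" for B p
  proof -
    let ?A = "Suc ` B"
    have i: "p + 1 \<in> {1..<2 * n}" using B by auto
    obtain A where A: "A \<subseteq> {1..2 * n} - {p + 1, p + 1 + 1}" "card A = n - 1"
      "move_vector n (p + 1) = unit_vector (insert (p + 1 + 1) A) - unit_vector (insert (p + 1) A)"
      using move_vectorE[OF i] .
    have "?A \<subseteq> {1..2 * n} - {p + 1, p + 1 + 1}" using B by auto
    moreover have "card ?A = n - 1" using B(5) by (simp add: card_image)
    ultimately have "(unit_vector (insert (p + 1 + 1) ?A) - unit_vector (insert (p + 1) ?A))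
        - move_vector n (p + 1) \<in> span (primitive_vectors n)"
      unfolding A(3) by (intro move_independent[OF i _ _ A(1,2)])
    then have "(F (insert (Suc p) B) - F (insert p B)) - move_vector n (p + 1) \<in> ?T"
      using span_mono[of "primitive_vectors n"] by (auto simp: F_def)
    moreover have "move_vector n (p + 1) \<in> ?T"
      by (rule span_base) (use B in \<open>force simp: complement_vector_def image_iff\<close>)
    ultimately have "F (insert (Suc p) B) - F (insert p B) - move_vector n (p + 1)
        + move_vector n (p + 1) \<in> ?T" by (rule span_add)
    then show ?thesis by simp
  qed
  have K': "K \<subseteq> {1..2 * n}" "card K = n" using K by (auto simp: plucker_indices_def)
  have "K \<subseteq> Suc ` {..<2 * n}"
    using K'(1) by (simp add: image_Suc_lessThan)
  then obtain B where B: "B \<subseteq> {..<2 * n}" "K = Suc ` B" by (auto simp: subset_image_iff)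
  have "F B - F {..<n} \<in> ?T"
    by (rule adjacent_moves_connected[where F = F, OF subspace_span move B(1)])
      (use B(2) K'(2) in \<open>auto simp: card_image\<close>)
  moreover have "F {..<n} \<in> ?T"
  proof (rule span_base)
    have "Suc ` {..<n} = {1..n}"
      by (simp add: image_Suc_lessThan)
    then have "F {..<n} = complement_vector n (2 * n - 1)"
      by (simp add: F_def complement_vector_def)
    then show "F {..<n} \<in> primitive_vectors n \<union> complement_vector n ` {..<2 * n}"
      using n by auto
  qed
  ultimately have "F B - F {..<n} + F {..<n} \<in> ?T" by (rule span_add)
  then show ?thesis by (simp add: F_def B(2))
qed

section \<open>Lower and upper estimates of the dimension\<close>

lemma cyclic_succ_in: "j \<in> {1..2 * n} \<Longrightarrow> cyclic_succ n j \<in> {1..2 * n}"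
  by (auto simp: cyclic_succ_def)

lemma primitive_index_plucker:
  assumes "primitive_index n i j D" "a \<in> {i, i + 1}" "b \<in> {j, cyclic_succ n j}"
  shows "{a, b} \<union> D \<in> plucker_indices n"
proof -
  have idx: "i \<in> {1..2 * n}" "j \<in> {1..2 * n}" "i < j" "D \<subseteq> {1..2 * n}" "card D + 2 = n"
    "i \<noteq> j" "i + 1 \<noteq> j" "i \<noteq> cyclic_succ n j" "i + 1 \<noteq> cyclic_succ n j"
    "i \<notin> D" "i + 1 \<notin> D" "j \<notin> D" "cyclic_succ n j \<notin> D"
    using assms(1) unfolding primitive_index_def by simp_all
  have c: "cyclic_succ n j \<in> {1..2 * n}" using idx(2) by (rule cyclic_succ_in)
  have "finite D" using idx(4) by (rule finite_subset) simp
  then have *: "{x, y} \<union> D \<in> plucker_indices n"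
    if "x \<notin> D" "y \<notin> D" "x \<noteq> y" "x \<in> {1..2 * n}" "y \<in> {1..2 * n}" for x y
    using that idx(4,5) by (simp add: plucker_indices_def)
  have "i + 1 \<in> {1..2 * n}" using idx(1-3) by simp
  then have "{i, j} \<union> D \<in> plucker_indices n" "{i + 1, j} \<union> D \<in> plucker_indices n"
    "{i, cyclic_succ n j} \<union> D \<in> plucker_indices n"
    "{i + 1, cyclic_succ n j} \<union> D \<in> plucker_indices n"
    by (intro *; use idx c in blast)+
  then show ?thesis
    using assms(2,3) by (elim insertE emptyE) (simp_all only:)
qed

lemma primitive_vectors_in_span:
  "primitive_vectors n \<subseteq> span (unit_vector ` plucker_indices n)"
proof clarify
  fix i j D assume "primitive_index n i j D"
  from primitive_index_plucker[OF this]
  show "ratio_vector (primitive_ratio n i j D) \<in> span (unit_vector ` plucker_indices n)"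
    unfolding ratio_vector_primitive
    by (intro span_diff span_add span_base imageI) auto
qed

text \<open>A basis of the primitive vectors and the 2n complement vectors together span all unit
  vectors, so they are at least as many.\<close>

lemma card_plucker_le_dim_primitive:
  assumes n: "n \<ge> 1"
  shows "card (plucker_indices n) \<le> dim (primitive_vectors n) + 2 * n"
proof -
  obtain B where B: "B \<subseteq> primitive_vectors n" "independent B" "primitive_vectors n \<subseteq> span B"
    "card B = dim (primitive_vectors n)"
    using basis_exists by blast
  have fB: "finite B"
    using independent_span_bound[OF finite_imageI[OF finite_plucker_indices] B(2)
        subset_trans[OF B(1) primitive_vectors_in_span]] by simp
  let ?t = "B \<union> complement_vector n ` {..<2 * n}"
  have "primitive_vectors n \<union> complement_vector n ` {..<2 * n} \<subseteq> span ?t"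
    using B(3) span_mono[of B ?t] by (auto intro: span_base)
  then have "span (primitive_vectors n \<union> complement_vector n ` {..<2 * n}) \<subseteq> span ?t"
    by (rule span_minimal) (rule subspace_span)
  then have "unit_vector ` plucker_indices n \<subseteq> span ?t"
    using unit_vectors_in_span[OF n] by blast
  then have "card (unit_vector ` plucker_indices n) \<le> card ?t"
    using independent_span_bound[of ?t, OF _ independent_single] fB by simp
  also have "\<dots> \<le> card B + card (complement_vector n ` {..<2 * n})"
    by (rule card_Un_le)
  also have "\<dots> \<le> card B + 2 * n"
    using card_image_le[of "{..<2 * n}" "complement_vector n"] by simp
  finally show ?thesis
    using B(4) by (simp add: card_image inj_on_subset[OF inj_single])
qed

text \<open>The same complement vectors now serve from the other side: added to a basis of
  \<open>S\<close> they stay independent, because suitable sums of incidences vanish on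
  \<open>S\<close> and separate them triangularly.\<close>

lemma dim_incidence_kernel_le:
  assumes n: "n \<ge> 1"
    and S: "S \<subseteq> span (unit_vector ` plucker_indices n)"
    and inc: "\<And>v j. v \<in> S \<Longrightarrow> j \<in> {1..2 * n} \<Longrightarrow> incidence n j v = 0"
  shows "dim S + 2 * n \<le> card (plucker_indices n)"
proof -
  obtain B where B: "B \<subseteq> S" "independent B" "card B = dim S"
    using basis_exists by metis
  have fB: "finite B"
    using independent_span_bound[OF finite_imageI[OF finite_plucker_indices] B(2) subset_trans[OF B(1) S]]
    by simp
  \<comment> \<open>For \<open>k < 2 * n - 1\<close>, \<open>\<phi> k\<close> counts the elements
    that are at least \<open>k + 2\<close>; moving \<open>j + 1\<close> to \<open>j + 2\<close>
    alters this count only for \<open>j = k\<close>. The last functional counts all elements: it is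
    blind to moves and takes the value \<open>n\<close> at
    \<open>unit_vector {1..n}\<close>.\<close>
  define \<phi> where "\<phi> k v = (\<Sum>j\<in>(if k < 2 * n - 1 then {k + 2..2 * n} else {1..2 * n}). incidence n j v)" for k v
  let ?t = "B \<union> complement_vector n ` {..<2 * n}"
  have \<phi>_move: "\<phi> k (move_vector n (j + 1)) = of_bool (j = k)"
    if "k < 2 * n - 1" "j \<le> k" for k j
  proof -
    have "\<phi> k (move_vector n (j + 1)) = (\<Sum>l\<in>{k + 2..2 * n}. of_bool (l = j + 2) - of_bool (l = j + 1))"
      using that by (simp add: \<phi>_def incidence_move_vector)
    also have "\<dots> = of_bool (j = k)"
      using that by (auto simp: sum_subtractf of_bool_def sum.delta)
    finally show ?thesis .
  qed
  have \<phi>_last: "\<phi> (2 * n - 1) (move_vector n (j + 1)) = 0" if "j < 2 * n - 1" for j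
  proof -
    have "\<phi> (2 * n - 1) (move_vector n (j + 1)) = (\<Sum>l\<in>{1..2 * n}. of_bool (l = j + 2) - of_bool (l = j + 1))"
      using that by (simp add: \<phi>_def incidence_move_vector)
    also have "\<dots> = 0"
      using that by (auto simp: sum_subtractf of_bool_def sum.delta)
    finally show ?thesis .
  qed
  have \<phi>_init: "\<phi> (2 * n - 1) (unit_vector {1..n}) \<noteq> 0"
  proof -
    have "\<phi> (2 * n - 1) (unit_vector {1..n}) = (\<Sum>l\<in>{1..2 * n}. of_bool (l \<in> {1..n}))"
      by (simp add: \<phi>_def incidence_unit_vector[OF initial_in_plucker_indices] del: One_nat_def)
    also have "\<dots> = real (card ({1..2 * n} \<inter> {l. l \<in> {1..n}}))"
      by (subst sum_of_bool_eq) auto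
    also have "{1..2 * n} \<inter> {l. l \<in> {1..n}} = {1..n}" by auto
    finally show ?thesis using n by simp
  qed
  have t: "independent ?t \<and> card ?t = card B + 2 * n"
  proof (rule independent_Un_triangular[OF B(2) fB, where \<phi> = \<phi>])
    fix k show "linear (\<phi> k)"
      unfolding \<phi>_def by (intro linear_compose_sum ballI linear_incidence)
  next
    fix k b assume "b \<in> B"
    then show "\<phi> k b = 0"
      using B(1) inc by (auto simp: \<phi>_def intro!: sum.neutral)
  next
    fix j k :: nat assume jk: "j < k" "k < 2 * n"
    show "\<phi> k (complement_vector n j) = 0"
    proof (cases "k < 2 * n - 1")
      case True
      then show ?thesis using jk \<phi>_move[of k j] by (simp add: complement_vector_def)
    next
      case False
      then have "k = 2 * n - 1" using jk by auto
      then show ?thesis using jk \<phi>_last[of j] by (simp add: complement_vector_def)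
    qed
  next
    fix k :: nat assume k: "k < 2 * n"
    show "\<phi> k (complement_vector n k) \<noteq> 0"
    proof (cases "k < 2 * n - 1")
      case True
      then show ?thesis using \<phi>_move[of k k] by (simp add: complement_vector_def)
    next
      case False
      then have "k = 2 * n - 1" using k by auto
      then show ?thesis using \<phi>_init by (simp add: complement_vector_def)
    qed
  qed
  have "?t \<subseteq> span (unit_vector ` plucker_indices n)"
    by (intro Un_least subset_trans[OF B(1) S] image_subsetI complement_vector_in_span[OF n])
  then have "card ?t \<le> card (unit_vector ` plucker_indices n)"
    using independent_span_bound[OF finite_imageI[OF finite_plucker_indices] conjunct1[OF t]] by simp
  then show ?thesis
    using B(3) t by (simp add: card_image inj_on_subset[OF inj_single])
qed

section \<open>Scaling totally positive matrices\<close>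

abbreviation detf :: "nat \<Rightarrow> (nat \<Rightarrow> nat \<Rightarrow> real) \<Rightarrow> real" where
  "detf m f \<equiv> Determinant.det (Matrix.mat m m (\<lambda>(i, j). f i j))"

lemma detf_cong: "(\<And>i j. i < m \<Longrightarrow> j < m \<Longrightarrow> f i j = g i j) \<Longrightarrow> detf m f = detf m g"
  by (rule arg_cong[of _ _ Determinant.det], rule eq_matI) auto

text \<open>Every Leibniz term has one factor from each row and each column, so it carries all the
  \<open>a i\<close> and all the \<open>b j\<close>.\<close>

lemma detf_scale:
  "detf m (\<lambda>i j. a i * b j * f i j) = (\<Prod>i<m. a i) * (\<Prod>j<m. b j) * detf m f"
proof -
  have "(\<Prod>i = 0..<m. a i * b (p i) * f i (p i))
      = (\<Prod>i<m. a i) * (\<Prod>j<m. b j) * (\<Prod>i = 0..<m. f i (p i))"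
    if "p permutes {0..<m}" for p
  proof -
    have "(\<Prod>i = 0..<m. b (p i)) = (\<Prod>j = 0..<m. b j)"
      using prod.permute[OF that, of b] by (simp add: o_def)
    then show ?thesis by (simp add: prod.distrib atLeast0LessThan)
  qed
  then show ?thesis
    unfolding det_def'[OF mat_carrier]
    by (auto simp: sum_distrib_left permutes_in_image mult_ac intro!: sum.cong prod.cong)
qed

text \<open>One step of Gaussian elimination, written as a product of a lower unitriangular
  \<open>L\<close> and a matrix \<open>U\<close> whose first column vanishes below the pivot. The
  remaining block is the Schur complement of \<open>f 0 0\<close>.\<close>

lemma detf_Suc_pivot:
  assumes "f 0 0 \<noteq> 0"
  shows "detf (Suc m) f = f 0 0 * detf m (\<lambda>i j. f (Suc i) (Suc j) - f (Suc i) 0 * f 0 (Suc j) / f 0 0)"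
proof -
  define L where "L = Matrix.mat (Suc m) (Suc m) (\<lambda>(i, j). if j = 0 then f i 0 / f 0 0 else of_bool (i = j))"
  define U where "U = Matrix.mat (Suc m) (Suc m)
    (\<lambda>(i, j). if i = 0 then f 0 j else if j = 0 then 0 else f i j - f i 0 * f 0 j / f 0 0)"
  have LU: "L \<in> carrier_mat (Suc m) (Suc m)" "U \<in> carrier_mat (Suc m) (Suc m)"
    by (simp_all add: L_def U_def)
  have "L * U = Matrix.mat (Suc m) (Suc m) (\<lambda>(i, j). f i j)"
  proof (rule eq_matI)
    fix i j assume "i < dim_row (Matrix.mat (Suc m) (Suc m) (\<lambda>(i, j). f i j))"
      "j < dim_col (Matrix.mat (Suc m) (Suc m) (\<lambda>(i, j). f i j))"
    then have ij: "i < Suc m" "j < Suc m" by simp_all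
    have "(L * U) $$ (i, j) = (\<Sum>k = 0..<Suc m. L $$ (i, k) * U $$ (k, j))"
      using ij LU by (simp add: scalar_prod_def)
    also have "\<dots> = L $$ (i, 0) * U $$ (0, j) + (\<Sum>k = Suc 0..<Suc m. L $$ (i, k) * U $$ (k, j))"
      by (rule sum.atLeast_Suc_lessThan) simp
    also have "(\<Sum>k = Suc 0..<Suc m. L $$ (i, k) * U $$ (k, j))
        = (\<Sum>k = Suc 0..<Suc m. if k = i then U $$ (k, j) else 0)"
      using ij by (intro sum.cong) (auto simp: L_def)
    also have "\<dots> = (if i = 0 then 0 else U $$ (i, j))"
      using ij by simp
    also have "L $$ (i, 0) * U $$ (0, j) + \<dots> = f i j"
      using ij assms by (simp add: L_def U_def)
    finally show "(L * U) $$ (i, j) = Matrix.mat (Suc m) (Suc m) (\<lambda>(i, j). f i j) $$ (i, j)"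
      using ij by simp
  qed (use LU in auto)
  moreover have "Determinant.det (L * U) = Determinant.det L * Determinant.det U"
    by (rule det_mult[OF LU])
  moreover have "Determinant.det L = 1"
  proof -
    have "Determinant.det L = prod_list (diag_mat L)"
      by (rule det_lower_triangular[OF _ LU(1)]) (auto simp: L_def)
    also have "diag_mat L = replicate (Suc m) 1"
      using assms by (intro nth_equalityI) (auto simp: diag_mat_def L_def nth_Cons' simp del: upt_Suc)
    finally show ?thesis by simp
  qed
  moreover have "Determinant.det U = f 0 0 * detf m (\<lambda>i j. f (Suc i) (Suc j) - f (Suc i) 0 * f 0 (Suc j) / f 0 0)"
  proof -
    have "Determinant.det U = (\<Sum>i<Suc m. U $$ (i, 0) * cofactor U i 0)"
      by (rule laplace_expansion_column[OF LU(2)]) simp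
    also have "\<dots> = f 0 0 * cofactor U 0 0"
      unfolding sum.lessThan_Suc_shift by (simp add: U_def)
    also have "mat_delete U 0 0 = Matrix.mat m m (\<lambda>(i, j). f (Suc i) (Suc j) - f (Suc i) 0 * f 0 (Suc j) / f 0 0)"
      by (rule eq_matI) (auto simp: mat_delete_def U_def)
    then have "cofactor U 0 0 = detf m (\<lambda>i j. f (Suc i) (Suc j) - f (Suc i) 0 * f 0 (Suc j) / f 0 0)"
      by (simp add: cofactor_def)
    finally show ?thesis .
  qed
  ultimately show ?thesis by simp
qed

text \<open>Pivoting on the first entry of a Cauchy matrix leaves a smaller Cauchy matrix, up to
  positive factors in the rows and columns.\<close>

lemma cauchy_det_pos:
  fixes x y :: "nat \<Rightarrow> real"
  assumes "\<And>i j. i < j \<Longrightarrow> j < m \<Longrightarrow> x i < x j" "\<And>i j. i < j \<Longrightarrow> j < m \<Longrightarrow> y i < y j"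
    and "\<And>i. i < m \<Longrightarrow> x i > 0" "\<And>i. i < m \<Longrightarrow> y i > 0"
  shows "detf m (\<lambda>i j. 1 / (x i + y j)) > 0"
  using assms
proof (induction m arbitrary: x y)
  case 0
  then show ?case by simp
next
  case (Suc m)
  have pos: "x i + y j > 0" if "i < Suc m" "j < Suc m" for i j
    using Suc.prems(3,4) that by (simp add: add_pos_pos)
  let ?a = "\<lambda>i. (x (Suc i) - x 0) / (x (Suc i) + y 0)"
  let ?b = "\<lambda>j. (y (Suc j) - y 0) / (x 0 + y (Suc j))"
  have "detf (Suc m) (\<lambda>i j. 1 / (x i + y j)) = 1 / (x 0 + y 0) *
    detf m (\<lambda>i j. 1 / (x (Suc i) + y (Suc j)) - 1 / (x (Suc i) + y 0) * (1 / (x 0 + y (Suc j))) / (1 / (x 0 + y 0)))"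
    by (rule detf_Suc_pivot) (use pos[of 0 0] in simp)
  also have "detf m (\<lambda>i j. 1 / (x (Suc i) + y (Suc j)) - 1 / (x (Suc i) + y 0) * (1 / (x 0 + y (Suc j))) / (1 / (x 0 + y 0)))
    = detf m (\<lambda>i j. ?a i * ?b j * (1 / (x (Suc i) + y (Suc j))))"
  proof (rule detf_cong)
    fix i j assume "i < m" "j < m"
    then have p: "x (Suc i) + y (Suc j) > 0" "x (Suc i) + y 0 > 0" "x 0 + y (Suc j) > 0" "x 0 + y 0 > 0"
      by (simp_all add: pos)
    have *: "1 / A - 1 / B * (1 / C) / (1 / D) = (B * C - A * D) / (A * B * C)"
      if "A > 0" "B > 0" "C > 0" "D > 0" for A B C D :: real
      using that by (simp add: field_simps)
    have num: "(x (Suc i) + y 0) * (x 0 + y (Suc j)) - (x (Suc i) + y (Suc j)) * (x 0 + y 0)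
        = (x (Suc i) - x 0) * (y (Suc j) - y 0)"
      by (simp add: algebra_simps)
    show "1 / (x (Suc i) + y (Suc j)) - 1 / (x (Suc i) + y 0) * (1 / (x 0 + y (Suc j))) / (1 / (x 0 + y 0))
      = ?a i * ?b j * (1 / (x (Suc i) + y (Suc j)))"
      unfolding *[OF p] num by (simp add: mult_ac)
  qed
  also have "\<dots> = (\<Prod>i<m. ?a i) * (\<Prod>j<m. ?b j) * detf m (\<lambda>i j. 1 / (x (Suc i) + y (Suc j)))"
    by (rule detf_scale)
  also have "1 / (x 0 + y 0) * \<dots> > 0"
  proof (intro mult_pos_pos prod_pos)
    show "detf m (\<lambda>i j. 1 / (x (Suc i) + y (Suc j))) > 0"
      by (rule Suc.IH) (use Suc.prems in auto)
  qed (use pos Suc.prems(1,2) in auto)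
  finally show ?case .
qed

lemma card_vimage_Suc:
  assumes "I \<subseteq> {1..n}"
  shows "card {i. i < n \<and> i \<in> Suc -` I} = card I" "card (Suc -` I) = card I"
    "finite (Suc -` I)" "Suc ` (Suc -` I) = I"
proof -
  show im: "Suc ` (Suc -` I) = I"
    using assms by (auto simp: image_iff) (metis Suc_le_D atLeastAtMost_iff One_nat_def subsetD)
  then show c: "card (Suc -` I) = card I"
    by (metis card_image inj_Suc inj_on_subset subset_UNIV)
  have "{i. i < n \<and> i \<in> Suc -` I} = Suc -` I" using assms by auto
  then show "card {i. i < n \<and> i \<in> Suc -` I} = card I" using c by simp
  show "finite (Suc -` I)"
    using assms by (intro finite_vimageI) (auto intro: finite_subset)
qed

lemma minor_eq_detf:
  assumes "X \<in> carrier_mat n n" "I \<subseteq> {1..n}" "J \<subseteq> {1..n}" "card I = card J"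
  shows "minor X I J = detf (card I) (\<lambda>i j. X $$ (pick (Suc -` I) i, pick (Suc -` J) j))"
proof -
  have "{i. i < n \<and> Suc i \<in> I} = {i. i < n \<and> i \<in> Suc -` I}" "{i. i < n \<and> Suc i \<in> J} = {i. i < n \<and> i \<in> Suc -` J}"
    by auto
  then show ?thesis
    using assms card_vimage_Suc[OF assms(2)] card_vimage_Suc[OF assms(3)]
    by (simp add: minor_def submatrix_def)
qed

lemma pick_strict_mono: "i < j \<Longrightarrow> j < card S \<Longrightarrow> pick S i < pick S j"
  by (rule pick_mono) auto

lemma bij_betw_pick:
  assumes "finite S"
  shows "bij_betw (pick S) {..<card S} S"
proof -
  have inj: "inj_on (pick S) {..<card S}"
    by (rule linorder_inj_onI) (auto dest: pick_strict_mono[of _ _ S])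
  moreover have "pick S ` {..<card S} = S"
    by (rule card_subset_eq) (use assms inj in \<open>auto simp: card_image intro: pick_in_set\<close>)
  ultimately show ?thesis by (simp add: bij_betw_def)
qed

text \<open>The factors are numbered from 1 like \<open>I\<close> and \<open>J\<close>, whence
  \<open>Suc\<close> at the matrix positions. They come out by \<open>detf_scale\<close> and are
  reindexed along \<open>pick\<close>.\<close>

lemma minor_scale:
  assumes "X \<in> carrier_mat n n" "I \<subseteq> {1..n}" "J \<subseteq> {1..n}" "card I = card J"
  shows "minor (Matrix.mat n n (\<lambda>(i, j). a (Suc i) * b (Suc j) * X $$ (i, j))) I J
    = (\<Prod>i\<in>I. a i) * (\<Prod>j\<in>J. b j) * minor X I J"
proof -
  let ?Y = "Matrix.mat n n (\<lambda>(i, j). a (Suc i) * b (Suc j) * X $$ (i, j))"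
  have lt: "pick (Suc -` S) i < n" if "S \<subseteq> {1..n}" "i < card S" for S i
    using that card_vimage_Suc[OF that(1)] by (intro pick_le) simp
  have prod: "(\<Prod>i<card S. c (Suc (pick (Suc -` S) i))) = (\<Prod>i\<in>S. c i)" if "S \<subseteq> {1..n}"
    for S and c :: "nat \<Rightarrow> real"
  proof -
    have "(\<Prod>i<card S. c (Suc (pick (Suc -` S) i))) = (\<Prod>i\<in>Suc -` S. c (Suc i))"
      using prod.reindex_bij_betw[OF bij_betw_pick[OF card_vimage_Suc(3)[OF that]], of "\<lambda>i. c (Suc i)"]
      by (simp add: card_vimage_Suc(2)[OF that])
    also have "\<dots> = (\<Prod>i\<in>Suc ` (Suc -` S). c i)" by (subst prod.reindex) simp_all
    finally show ?thesis by (simp only: card_vimage_Suc(4)[OF that])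
  qed
  have "minor ?Y I J = detf (card I) (\<lambda>i j. ?Y $$ (pick (Suc -` I) i, pick (Suc -` J) j))"
    by (rule minor_eq_detf) (use assms in auto)
  also have "\<dots> = detf (card I) (\<lambda>i j. a (Suc (pick (Suc -` I) i)) * b (Suc (pick (Suc -` J) j))
      * X $$ (pick (Suc -` I) i, pick (Suc -` J) j))"
    by (rule detf_cong) (use assms lt in simp)
  also have "\<dots> = (\<Prod>i\<in>I. a i) * (\<Prod>j\<in>J. b j) * minor X I J"
    unfolding detf_scale using assms prod[of I a] prod[of J b] by (simp add: minor_eq_detf)
  finally show ?thesis .
qed

text \<open>Every minor is a Cauchy determinant whose nodes are the chosen row and column numbers,
  positive and increasing.\<close>

lemma totally_positive_hilbert:
  "totally_positive n (Matrix.mat n n (\<lambda>(i, j). 1 / (real (Suc i) + real (Suc j))))"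
  (is "totally_positive n ?X")
  unfolding totally_positive_def
proof (intro conjI allI impI; (elim conjE)?)
  fix I J assume IJ: "I \<subseteq> {1..n}" "J \<subseteq> {1..n}" "card I = card J"
  have lt: "pick (Suc -` S) i < n" if "S \<subseteq> {1..n}" "i < card S" for S i
    using that card_vimage_Suc[OF that(1)] by (intro pick_le) simp
  let ?x = "\<lambda>i. real (Suc (pick (Suc -` I) i))" and ?y = "\<lambda>i. real (Suc (pick (Suc -` J) i))"
  have "minor ?X I J = detf (card I) (\<lambda>i j. ?X $$ (pick (Suc -` I) i, pick (Suc -` J) j))"
    by (rule minor_eq_detf) (use IJ in auto)
  also have "\<dots> = detf (card I) (\<lambda>i j. 1 / (?x i + ?y j))"
    by (rule detf_cong) (use IJ lt in simp)
  also have "\<dots> > 0"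
    by (rule cauchy_det_pos) (use IJ card_vimage_Suc pick_strict_mono in auto)
  finally show "minor ?X I J > 0" .
qed simp

section \<open>Pluecker coordinates on totally positive matrices\<close>

definition plucker_rows :: "nat \<Rightarrow> nat set \<Rightarrow> nat set" where
  "plucker_rows n K = K \<inter> {1..n}"

definition plucker_cols :: "nat \<Rightarrow> nat set \<Rightarrow> nat set" where
  "plucker_cols n K = {1..n} - (\<lambda>k. 2 * n + 1 - k) ` {k \<in> K. k \<ge> n + 1}"

lemma plucker_eq_minor: "plucker n X K = minor X (plucker_rows n K) (plucker_cols n K)"
  by (simp add: plucker_def plucker_rows_def plucker_cols_def)

text \<open>If \<open>K\<close> has s elements above \<open>n\<close>, then n - s rows are chosen,
  and exactly s columns are struck out since \<open>k\<close> determines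
  \<open>2 * n + 1 - k\<close> injectively.\<close>

lemma card_plucker_rows_cols:
  assumes "K \<in> plucker_indices n"
  shows "card (plucker_rows n K) = card (plucker_cols n K)"
proof -
  have K: "K \<subseteq> {1..2 * n}" "card K = n" "finite K"
    using assms finite_subset by (auto simp: plucker_indices_def)
  let ?L = "{k \<in> K. k \<ge> n + 1}"
  have "card K = card (plucker_rows n K) + card ?L"
    using K by (subst card_Un_disjoint[symmetric]) (auto simp: plucker_rows_def intro!: arg_cong[of _ _ card])
  moreover have "card ((\<lambda>k. 2 * n + 1 - k) ` ?L) = card ?L"
    by (rule card_image, rule inj_onI) (use K in force)
  moreover have "(\<lambda>k. 2 * n + 1 - k) ` ?L \<subseteq> {1..n}"
    using subsetD[OF K(1)] by fastforce
  ultimately show ?thesis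
    using K card_Diff_subset[of "(\<lambda>k. 2 * n + 1 - k) ` ?L" "{1..n}"]
    by (simp add: plucker_cols_def finite_subset)
qed

lemma plucker_pos:
  assumes "totally_positive n X" "K \<in> plucker_indices n"
  shows "plucker n X K > 0"
  using assms card_plucker_rows_cols[OF assms(2)]
  unfolding totally_positive_def plucker_eq_minor
  by (auto simp: plucker_rows_def plucker_cols_def)

lemma mem_plucker_cols:
  assumes "K \<in> plucker_indices n" "k \<in> {n + 1..2 * n}"
  shows "2 * n + 1 - k \<in> plucker_cols n K \<longleftrightarrow> k \<notin> K"
proof -
  have "k = l" if "2 * n + 1 - k = 2 * n + 1 - l" "l \<in> K" for l
    using that assms by (auto simp: plucker_indices_def)
  then show ?thesis using assms by (auto simp: plucker_cols_def)
qed

text \<open>For \<open>k \<le> n\<close> a row of \<open>X\<close> is multiplied by \<open>t\<close>, for \<open>k > n\<close> a column is divided by \<open>t\<close>: the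
  latter multiplies all maximal minors of the stacked matrix by \<open>1 / t\<close>, except that those using
  its \<open>k\<close>-th row keep their value.\<close>

lemma exists_scaled_totally_positive:
  assumes X: "totally_positive n X" and k: "k \<in> {1..2 * n}" and t: "t > 0"
  shows "\<exists>Y c. totally_positive n Y \<and> c > 0 \<and>
    (\<forall>K\<in>plucker_indices n. plucker n Y K = c * (if k \<in> K then t else 1) * plucker n X K)"
proof -
  define a where "a i = (if i = k then t else 1)" for i
  \<comment> \<open>For \<open>k \<le> n\<close> this column number exceeds \<open>n\<close>, so on
    \<open>{1..n}\<close> at most one of \<open>a\<close> and \<open>b\<close> differs from the
    constant 1.\<close>
  define b where "b j = (if j = 2 * n + 1 - k then 1 / t else 1)" for j
  have carr: "X \<in> carrier_mat n n" using X by (simp add: totally_positive_def)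
  let ?Y = "Matrix.mat n n (\<lambda>(i, j). a (Suc i) * b (Suc j) * X $$ (i, j))"
  have ab: "(\<Prod>i\<in>I. a i) > 0" "(\<Prod>i\<in>I. b i) > 0" for I
    using t by (auto simp: a_def b_def intro!: prod_pos)
  note sc = minor_scale[OF carr, of _ _ a b]
  have "totally_positive n ?Y"
    using X ab by (auto simp: totally_positive_def sc)
  moreover have "\<exists>c>0. \<forall>K\<in>plucker_indices n. plucker n ?Y K = c * (if k \<in> K then t else 1) * plucker n X K"
  proof -
    have fin: "finite (plucker_rows n K)" "finite (plucker_cols n K)" for K
      by (auto simp: plucker_rows_def plucker_cols_def)
    have p: "plucker n ?Y K = (if k \<in> plucker_rows n K then t else 1)
       * (if 2 * n + 1 - k \<in> plucker_cols n K then 1 / t else 1) * plucker n X K"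
      if "K \<in> plucker_indices n" for K
      unfolding plucker_eq_minor
      by (subst sc) (use card_plucker_rows_cols[OF that] fin in
        \<open>auto simp: plucker_rows_def plucker_cols_def a_def b_def prod.delta\<close>)
    show ?thesis
    proof (cases "k \<le> n")
      case True
      then have "2 * n + 1 - k \<notin> plucker_cols n K" "k \<in> plucker_rows n K \<longleftrightarrow> k \<in> K" for K
        using k by (auto simp: plucker_cols_def plucker_rows_def)
      then show ?thesis using p by (intro exI[of _ 1]) auto
    next
      case False
      then have "k \<notin> plucker_rows n K" for K by (auto simp: plucker_rows_def)
      moreover have "2 * n + 1 - k \<in> plucker_cols n K \<longleftrightarrow> k \<notin> K" if "K \<in> plucker_indices n" for K
        using mem_plucker_cols[OF that] False k by auto
      ultimately show ?thesis using p t by (intro exI[of _ "1 / t"]) auto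
    qed
  qed
  ultimately show ?thesis by blast
qed

section \<open>Boundedness along a scaling orbit\<close>

lemma powi_sum:
  fixes t :: real
  assumes "t \<noteq> 0" "finite A"
  shows "(\<Prod>x\<in>A. t powi f x) = t powi (\<Sum>x\<in>A. f x)"
  using assms(2) by induction (use assms(1) in \<open>simp_all add: power_int_add\<close>)

text \<open>With a positive exponent the left side is unbounded for large \<open>t\<close>; a
  negative exponent becomes positive on replacing \<open>t\<close> by its inverse.\<close>

lemma exponent_zero_if_bounded:
  fixes r C :: real
  assumes "r > 0" and bnd: "\<And>t. t > 0 \<Longrightarrow> r * t powi e \<le> C"
  shows "e = 0"
proof -
  have *: False if "e' > 0" and b: "\<And>t. t > 0 \<Longrightarrow> r * t powi e' \<le> C" for e' :: int
  proof -
    \<comment> \<open>At least 1, so that \<open>t powi e'\<close> is at least \<open>t\<close>, and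
      beyond \<open>C / r\<close>.\<close>
    define t where "t = max 1 (C / r + 1)"
    have t: "t \<ge> 1" "t > C / r" by (auto simp: t_def)
    have "t powi 1 \<le> t powi e'"
      by (rule power_int_increasing) (use t that in auto)
    then have "C / r < t powi e'" using t by simp
    then have "C < r * t powi e'" using assms(1) by (simp add: field_simps)
    then show False using b[of t] t by simp
  qed
  have "\<not> e > 0" using *[of e] bnd by blast
  moreover have "\<not> - e > 0"
  proof
    assume "- e > 0"
    moreover have "r * t powi (- e) \<le> C" if "t > 0" for t
      using bnd[of "inverse t"] that by (simp add: power_int_minus power_int_inverse)
    ultimately show False using *[of "- e"] by blast
  qed
  ultimately show ?thesis by simp
qed

text \<open>Scaling one fixed totally positive \<open>X\<close> multiplies the ratio by
  \<open>t powi ?e\<close>, since the common factor \<open>c\<close> cancels when the exponents sum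
  to zero. Boundedness for all \<open>t > 0\<close> then forces \<open>?e = 0\<close>.\<close>

lemma bounded_ratio_incidence:
  assumes \<alpha>: "bounded_ratio n \<alpha>" and k: "k \<in> {1..2 * n}"
  shows "(\<Sum>K\<in>{K \<in> plucker_indices n. k \<in> K}. Poly_Mapping.lookup \<alpha> K) = 0" (is "?e = 0")
proof -
  let ?P = "plucker_indices n" and ?\<alpha> = "Poly_Mapping.lookup \<alpha>"
  have fin: "finite ?P" by (simp add: plucker_indices_def)
  obtain C where C: "\<And>X. totally_positive n X \<Longrightarrow> ratio_value n \<alpha> X \<le> C"
    using \<alpha> by (auto simp: bounded_ratio_def)
  have deg: "(\<Sum>K\<in>?P. ?\<alpha> K) = 0" using \<alpha> by (simp add: bounded_ratio_def is_ratio_def)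
  obtain X where X: "totally_positive n X" using totally_positive_hilbert by blast
  show ?thesis
  proof (rule exponent_zero_if_bounded)
    show "ratio_value n \<alpha> X > 0"
      unfolding ratio_value_def by (intro prod_pos zero_less_power_int plucker_pos[OF X])
    fix t :: real assume t: "t > 0"
    obtain Y c where Y: "totally_positive n Y" "c > 0"
      "\<And>K. K \<in> ?P \<Longrightarrow> plucker n Y K = c * (if k \<in> K then t else 1) * plucker n X K"
      using exists_scaled_totally_positive[OF X k t] by blast
    have "ratio_value n \<alpha> Y = (\<Prod>K\<in>?P. c powi ?\<alpha> K * t powi (if k \<in> K then ?\<alpha> K else 0) * plucker n X K powi ?\<alpha> K)"
      unfolding ratio_value_def by (rule prod.cong) (auto simp: Y(3) power_int_mult_distrib)
    also have "\<dots> = c powi (\<Sum>K\<in>?P. ?\<alpha> K) * t powi (\<Sum>K\<in>?P. if k \<in> K then ?\<alpha> K else 0) * ratio_value n \<alpha> X"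
      using t Y(2) fin by (simp add: prod.distrib powi_sum ratio_value_def)
    also have "(\<Sum>K\<in>?P. if k \<in> K then ?\<alpha> K else 0) = ?e"
      by (rule sum.inter_filter[symmetric, OF fin])
    finally show "ratio_value n \<alpha> X * t powi ?e \<le> C"
      using C[OF Y(1)] deg by (simp add: mult.commute)
  qed
qed

section \<open>The three-term Pluecker relation\<close>

text \<open>Rows are functions on all of \<open>nat\<close>, cut to as many columns as there are
  rows. A list keeps their order explicit, so that the signs of exchanges can be followed.\<close>

definition row_det :: "(nat \<Rightarrow> real) list \<Rightarrow> real" where
  "row_det rs = detf (length rs) (\<lambda>i. rs ! i)"

lemma row_det_map: "row_det (map r (map s [0..<m])) = detf m (\<lambda>i j. r (s i) j)"
  unfolding row_det_def by (rule arg_cong[of _ _ Determinant.det], rule eq_matI) auto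

lemma row_det_swap: "row_det (xs @ a # b # ys) = - row_det (xs @ b # a # ys)"
proof -
  let ?k = "length xs" and ?n = "length (xs @ b # a # ys)"
  let ?A = "Matrix.mat ?n ?n (\<lambda>(i, j). ((xs @ b # a # ys) ! i) j)"
  have "Matrix.mat ?n ?n (\<lambda>(i, j). ((xs @ a # b # ys) ! i) j) = swaprows ?k (Suc ?k) ?A"
    by (rule eq_matI) (auto simp: nth_append nth_Cons' Suc_diff_le)
  moreover have "Determinant.det (swaprows ?k (Suc ?k) ?A) = - Determinant.det ?A"
    by (rule det_swaprows[where n = ?n]) auto
  ultimately show ?thesis by (simp add: row_det_def)
qed

text \<open>Writing all rows in terms of an invertible matrix, two of whose rows are varied, leaves
  a \<open>2 \<times> 2\<close> minor of the coefficients.\<close>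

lemma row_det_rank_two:
  assumes nz: "row_det (a # b # rs) \<noteq> 0"
  shows "\<exists>f g. \<forall>x y. row_det (x # y # rs) = row_det (a # b # rs) * (f x * g y - g x * f y)"
proof -
  define m where "m = length rs"
  define n where "n = Suc (Suc m)"
  define M where "M = Matrix.mat n n (\<lambda>(i, j). ((a # b # rs) ! i) j)"
  have M: "M \<in> carrier_mat n n" by (simp add: M_def)
  have dM: "Determinant.det M = row_det (a # b # rs)"
    by (simp add: row_det_def M_def n_def m_def)
  \<comment> \<open>\<open>w x\<close> holds the coordinates of \<open>x\<close> in the basis formed
    by the rows of \<open>M\<close>: the row vector \<open>x\<close> times the inverse of
    \<open>M\<close>, written with the adjugate.\<close>
  define w where "w x j = (\<Sum>k<n. x k * adj_mat M $$ (k, j)) / Determinant.det M" for x :: "nat \<Rightarrow> real" and j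
  have adj: "adj_mat M \<in> carrier_mat n n" "adj_mat M * M = Determinant.det M \<cdot>\<^sub>m 1\<^sub>m n"
    using adj_mat[OF M] by auto
  have w: "(\<Sum>j<n. w x j * M $$ (j, l)) = x l" if l: "l < n" for x l
  proof -
    have "(\<Sum>j<n. w x j * M $$ (j, l)) = (\<Sum>j<n. \<Sum>k<n. x k * adj_mat M $$ (k, j) * M $$ (j, l)) / Determinant.det M"
      by (simp add: w_def sum_divide_distrib sum_distrib_right)
    also have "(\<Sum>j<n. \<Sum>k<n. x k * adj_mat M $$ (k, j) * M $$ (j, l))
        = (\<Sum>k<n. x k * (\<Sum>j<n. adj_mat M $$ (k, j) * M $$ (j, l)))"
      by (subst sum.swap) (simp add: sum_distrib_left mult.assoc)
    also have "\<dots> = (\<Sum>k<n. x k * (adj_mat M * M) $$ (k, l))"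
      using adj(1) M l by (intro sum.cong) (auto simp: scalar_prod_def atLeast0LessThan)
    also have "\<dots> = (\<Sum>k<n. if k = l then x k * Determinant.det M else 0)"
      unfolding adj(2) using l by (intro sum.cong) auto
    also have "\<dots> = x l * Determinant.det M" using l by simp
    finally show ?thesis using nz dM by simp
  qed
  have "row_det (x # y # rs) = Determinant.det M * (w x 0 * w y 1 - w x 1 * w y 0)" for x y
  proof -
    define A where "A = Matrix.mat 2 2 (\<lambda>(i, j). w (if i = 0 then x else y) j)"
    define B where "B = Matrix.mat 2 m (\<lambda>(i, j). w (if i = 0 then x else y) (j + 2))"
    \<comment> \<open>\<open>Q\<close> expresses the rows \<open>x\<close>, \<open>y\<close> and
      \<open>rs\<close> through the rows of \<open>M\<close>. The rows \<open>rs\<close> already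
      belong to \<open>M\<close>, which gives the identity block and leaves the determinant of
      \<open>A\<close>.\<close>
    define Q where "Q = four_block_mat A B (0\<^sub>m m 2) (1\<^sub>m m)"
    have Q: "Q \<in> carrier_mat n n"
      unfolding Q_def n_def A_def by auto
    have Q0: "Q $$ (i, j) = w (if i = 0 then x else y) j" if "i < 2" "j < n" for i j
    proof (cases "j < 2")
      case True
      then show ?thesis using that by (simp add: Q_def A_def B_def n_def)
    next
      case False
      then obtain l where "j = 2 + l" by (metis le_Suc_ex not_less)
      then show ?thesis using that by (simp add: Q_def A_def B_def n_def)
    qed
    have Q2: "Q $$ (i, j) = of_bool (i = j)" if "2 \<le> i" "i < n" "j < n" for i j
      using that by (auto simp: Q_def A_def B_def n_def)
    have "Q * M = Matrix.mat n n (\<lambda>(i, j). ((x # y # rs) ! i) j)"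
    proof (rule eq_matI)
      fix i l assume "i < dim_row (Matrix.mat n n (\<lambda>(i, j). ((x # y # rs) ! i) j))"
        "l < dim_col (Matrix.mat n n (\<lambda>(i, j). ((x # y # rs) ! i) j))"
      then have il: "i < n" "l < n" by simp_all
      have "(Q * M) $$ (i, l) = (\<Sum>j<n. Q $$ (i, j) * M $$ (j, l))"
        using il Q M by (simp add: scalar_prod_def atLeast0LessThan)
      also have "\<dots> = ((x # y # rs) ! i) l"
      proof (cases "i < 2")
        case True
        then have "(\<Sum>j<n. Q $$ (i, j) * M $$ (j, l)) = (if i = 0 then x else y) l"
          using w[OF il(2)] by (simp add: Q0)
        with True show ?thesis by (auto simp: nth_Cons' less_Suc_eq numeral_2_eq_2)
      next
        case False
        then have "(\<Sum>j<n. Q $$ (i, j) * M $$ (j, l)) = (\<Sum>j<n. if j = i then M $$ (j, l) else 0)"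
          using il by (intro sum.cong) (auto simp: Q2)
        also have "\<dots> = M $$ (i, l)" using il by simp
        also have "\<dots> = ((x # y # rs) ! i) l" using il False by (auto simp: M_def nth_Cons')
        finally show ?thesis .
      qed
      finally show "(Q * M) $$ (i, l) = Matrix.mat n n (\<lambda>(i, j). ((x # y # rs) ! i) j) $$ (i, l)"
        using il by simp
    qed (use Q M in auto)
    then have "row_det (x # y # rs) = Determinant.det (Q * M)"
      by (simp add: row_det_def n_def m_def)
    also have "\<dots> = Determinant.det Q * Determinant.det M" by (rule det_mult[OF Q M])
    also have "Determinant.det Q = Determinant.det A * Determinant.det (1\<^sub>m m)"
      unfolding Q_def by (rule det_four_block_mat_lower_left_zero) (auto simp: A_def B_def)
    also have "Determinant.det A = w x 0 * w y 1 - w x 1 * w y 0"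
    proof -
      have A: "A \<in> carrier_mat 2 2" by (simp add: A_def)
      have d: "mat_delete A 0 0 \<in> carrier_mat 1 1" "mat_delete A 0 1 \<in> carrier_mat 1 1"
        using mat_delete_carrier[OF A] by auto
      have e: "Determinant.det (mat_delete A 0 0) = A $$ (1, 1)"
        "Determinant.det (mat_delete A 0 1) = A $$ (1, 0)"
        unfolding det_single[OF d(1)] det_single[OF d(2)] by (simp_all add: A_def mat_delete_def)
      have "Determinant.det A = (\<Sum>j<2. A $$ (0, j) * cofactor A 0 j)"
        by (rule laplace_expansion_row[OF A]) simp
      also have "\<dots> = A $$ (0, 0) * A $$ (1, 1) - A $$ (0, 1) * A $$ (1, 0)"
        using e by (simp add: numeral_2_eq_2 cofactor_def)
      finally show ?thesis by (simp add: A_def)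
    qed
    finally show ?thesis by simp
  qed
  then show ?thesis unfolding dM by (intro exI allI)
qed

text \<open>Carrying \<open>a\<close> to its place exchanges it with each smaller element, at the
  cost of one sign each. In the induction the prefix \<open>zs\<close> absorbs the elements already
  passed.\<close>

lemma row_det_insort:
  assumes "sorted xs"
  shows "row_det (map r (zs @ insort a xs))
    = (-1) ^ length (filter (\<lambda>d. d < a) xs) * row_det (map r (zs @ a # xs))"
  using assms
proof (induction xs arbitrary: zs)
  case Nil
  then show ?case by simp
next
  case (Cons b xs)
  show ?case
  proof (cases "a \<le> b")
    case True
    then have "filter (\<lambda>d. d < a) (b # xs) = []"
      using Cons.prems by (auto simp: filter_empty_conv)
    then show ?thesis using True by simp
  next
    case False
    then have "row_det (map r (zs @ insort a (b # xs))) = row_det (map r ((zs @ [b]) @ insort a xs))"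
      by simp
    also have "\<dots> = (-1) ^ length (filter (\<lambda>d. d < a) xs) * row_det (map r ((zs @ [b]) @ a # xs))"
      by (rule Cons.IH) (use Cons.prems in simp)
    also have "row_det (map r ((zs @ [b]) @ a # xs)) = - row_det (map r (zs @ a # b # xs))"
      using row_det_swap[of "map r zs" "r b" "r a" "map r xs"] by simp
    finally show ?thesis using False by simp
  qed
qed

lemma row_det_sorted_insert:
  assumes "finite D" "a \<notin> D"
  shows "row_det (map r (zs @ sorted_list_of_set (insert a D)))
    = (-1) ^ card {d \<in> D. d < a} * row_det (map r (zs @ a # sorted_list_of_set D))"
proof -
  have "length (filter (\<lambda>d. d < a) (sorted_list_of_set D)) = card {d \<in> D. d < a}"
    using assms(1) by (subst distinct_length_filter) (auto intro!: arg_cong[of _ _ card])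
  then show ?thesis
    using assms row_det_insort[of "sorted_list_of_set D" r zs a]
    by (simp add: sorted_list_of_set_insert_remove)
qed

text \<open>With unsorted rows the determinants are, up to a common factor, minors of size 2 by
  \<open>row_det_rank_two\<close>, and for these the relation is a polynomial identity. Sorting
  contributes \<open>\<epsilon> x * \<epsilon> y\<close>, so all three products carry the same
  sign.\<close>

lemma three_term_relation:
  fixes r :: "nat \<Rightarrow> nat \<Rightarrow> real" and D :: "nat set"
  defines "p \<equiv> \<lambda>x y. row_det (map r (sorted_list_of_set ({x, y} \<union> D)))"
  assumes D: "finite D" "{a, b, c, d} \<inter> D = {}" and ord: "a < b" "b < c" "c < d"
    and nz: "p a b \<noteq> 0"
  shows "p a b * p c d + p a d * p b c = p a c * p b d"
proof -
  define \<epsilon> :: "nat \<Rightarrow> real" where "\<epsilon> x = (-1) ^ card {d \<in> D. d < x}" for x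
  define B where "B x y = row_det (r x # r y # map r (sorted_list_of_set D))" for x y
  have p: "p x y = \<epsilon> x * \<epsilon> y * B x y" if "x < y" "x \<notin> D" "y \<notin> D" for x y
  proof -
    have "p x y = row_det (map r ([] @ sorted_list_of_set (insert x (insert y D))))"
      by (simp add: p_def)
    also have "\<dots> = (-1) ^ card {d \<in> insert y D. d < x} * row_det (map r ([] @ x # sorted_list_of_set (insert y D)))"
      by (rule row_det_sorted_insert) (use D that in auto)
    \<comment> \<open>Since \<open>x < y\<close>, the row of \<open>x\<close> does not pass that of
      \<open>y\<close>.\<close>
    also have "{d \<in> insert y D. d < x} = {d \<in> D. d < x}" using that by auto
    also have "row_det (map r ([] @ x # sorted_list_of_set (insert y D))) = \<epsilon> y * B x y"
      using row_det_sorted_insert[OF D(1) that(3), of r "[x]"] by (simp add: \<epsilon>_def B_def)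
    finally show ?thesis by (simp add: \<epsilon>_def)
  qed
  have out: "a \<notin> D" "b \<notin> D" "c \<notin> D" "d \<notin> D" using D(2) by auto
  have "B a b \<noteq> 0" using nz p[OF ord(1) out(1,2)] by auto
  then obtain f g where fg: "\<And>x y. B x y = B a b * (f (r x) * g (r y) - g (r x) * f (r y))"
    using row_det_rank_two[of "r a" "r b" "map r (sorted_list_of_set D)"] unfolding B_def by blast
  have "B a b * B c d + B a d * B b c = B a c * B b d"
    unfolding fg[of c d] fg[of a d] fg[of b c] fg[of a c] fg[of b d]
    \<comment> \<open>\<open>fg[of a b]\<close> has \<open>B a b\<close> on its own right side, so
      it is applied at one occurrence only. Each product is then the square of \<open>B a b\<close>
      times two minors of size 2.\<close>
    by (subst (1) fg[of a b]) (simp add: algebra_simps)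
  then have "\<epsilon> a * \<epsilon> b * \<epsilon> c * \<epsilon> d * (B a b * B c d + B a d * B b c) = \<epsilon> a * \<epsilon> b * \<epsilon> c * \<epsilon> d * (B a c * B b d)"
    by simp
  then show ?thesis
    using ord out by (simp add: p algebra_simps)
qed

section \<open>Pluecker coordinates as maximal minors of the stacked matrix\<close>

definition set_det :: "(nat \<Rightarrow> nat \<Rightarrow> real) \<Rightarrow> nat set \<Rightarrow> nat set \<Rightarrow> real" where
  "set_det f K J = detf (card K) (\<lambda>i j. f (pick K i) (pick J j))"

text \<open>The position of an element under \<open>pick\<close> is its number of smaller elements;
  deleting \<open>c\<close> lowers it by one exactly for the elements beyond
  \<open>c\<close>.\<close>

lemma pick_remove:
  assumes J: "finite J" "c \<in> J" and j: "j < card J - 1"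
  shows "pick (J - {c}) j = pick J (if j < card {a \<in> J. a < c} then j else Suc j)"
proof -
  define q where "q = card {a \<in> J. a < c}"
  define j' where "j' = (if j < q then j else Suc j)"
  define x where "x = pick J j'"
  have j': "j' < card J" "j' \<noteq> q" using j by (auto simp: j'_def)
  have c: "pick J q = c" unfolding q_def by (rule pick_card_in_set[OF J(2)])
  have x: "x \<in> J" "card {a \<in> J. a < x} = j'"
    using j' by (auto simp: x_def pick_in_set card_pick)
  have "x \<noteq> c" using x(2) j' q_def by auto
  have "q < card J"
    unfolding q_def by (rule psubset_card_mono) (use J in auto)
  have "card {a \<in> J - {c}. a < x} = j"
  proof (cases "j < q")
    case True
    then have "x < c" using pick_strict_mono[OF True \<open>q < card J\<close>] c by (simp add: x_def j'_def)
    then have "{a \<in> J - {c}. a < x} = {a \<in> J. a < x}" by auto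
    then show ?thesis using x True by (simp add: j'_def)
  next
    case False
    then have "q < j'" by (simp add: j'_def)
    then have "c < x" using pick_strict_mono[of q j' J] j'(1) c by (simp add: x_def)
    then have "{a \<in> J - {c}. a < x} = {a \<in> J. a < x} - {c}" "c \<in> {a \<in> J. a < x}"
      using J by auto
    then show ?thesis using x False J by (simp add: j'_def)
  qed
  then have "pick (J - {c}) j = x"
    using pick_card_in_set[of x "J - {c}"] x \<open>x \<noteq> c\<close> by auto
  then show ?thesis by (simp add: x_def j'_def q_def)
qed

text \<open>Laplace expansion along the last row, which belongs to the maximum \<open>k\<close> and
  can be nonzero only in column \<open>c\<close>. The exponent adds the positions of
  \<open>k\<close> and \<open>c\<close>, counted from 0.\<close>

lemma set_det_remove_Max:
  assumes K: "finite K" "k \<in> K" "\<And>l. l \<in> K \<Longrightarrow> l \<le> k"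
    and J: "finite J" "c \<in> J" "card K = card J"
    and zero: "\<And>l. l \<in> J \<Longrightarrow> l \<noteq> c \<Longrightarrow> f k l = 0"
  shows "set_det f K J = (-1) ^ (card K - 1 + card {j \<in> J. j < c}) * f k c * set_det f (K - {k}) (J - {c})"
proof -
  define m where "m = card K - 1"
  define q where "q = card {j \<in> J. j < c}"
  have "card K > 0" using K card_gt_0_iff by blast
  then have m: "card K = Suc m" "card J = Suc m" using J(3) by (simp_all add: m_def)
  have "{l \<in> K. l < k} = K - {k}" using K by (auto simp: le_less)
  then have mk: "m = card {l \<in> K. l < k}" using K by (simp add: m_def)
  have pk: "pick K m = k" unfolding mk by (rule pick_card_in_set[OF K(2)])
  have pq: "pick J q = c" unfolding q_def by (rule pick_card_in_set[OF J(2)])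
  have q: "q < Suc m"
    unfolding q_def m(2)[symmetric] by (rule psubset_card_mono) (use J in auto)
  define A where "A = Matrix.mat (Suc m) (Suc m) (\<lambda>(i, j). f (pick K i) (pick J j))"
  have A: "A \<in> carrier_mat (Suc m) (Suc m)" by (simp add: A_def)
  have row: "A $$ (m, j) = (if j = q then f k c else 0)" if "j < Suc m" for j
  proof (cases "j = q")
    case False
    have "j \<in> {..<card J}" "q \<in> {..<card J}" using that q m(2) by simp_all
    then have "pick J j \<noteq> pick J q"
      using inj_onD[OF bij_betw_imp_inj_on[OF bij_betw_pick[OF J(1)]]] False by metis
    moreover have "pick J j \<in> J" using that m by (intro pick_in_set) simp
    ultimately show ?thesis using zero that False by (simp add: A_def pk pq)
  qed (use that pk pq in \<open>simp add: A_def\<close>)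
  have pK: "pick (K - {k}) i = pick K i" if "i < m" for i
    using pick_remove[OF K(1,2), of i] that unfolding mk[symmetric] m(1) by simp
  have pJ: "pick (J - {c}) j = pick J (if j < q then j else Suc j)" if "j < m" for j
    using pick_remove[OF J(1,2), of j] that unfolding q_def[symmetric] m(2) by simp
  have "A $$ (m, j) * cofactor A m j = (if j = q then f k c * cofactor A m q else 0)"
    if "j \<in> {..<Suc m}" for j
    using row[of j] that by simp
  then have "(\<Sum>j<Suc m. A $$ (m, j) * cofactor A m j)
      = (\<Sum>j<Suc m. if j = q then f k c * cofactor A m q else 0)"
    by (rule sum.cong[OF refl])
  then have 1: "set_det f K J = f k c * cofactor A m q"
    using laplace_expansion_row[OF A, of m] q
    by (simp add: set_det_def A_def[symmetric] m(1) sum.delta del: sum.lessThan_Suc)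
  have "mat_delete A m q = Matrix.mat m m (\<lambda>(i, j). f (pick (K - {k}) i) (pick (J - {c}) j))"
    by (rule eq_matI) (auto simp: mat_delete_def A_def pK pJ)
  then have "Determinant.det (mat_delete A m q) = set_det f (K - {k}) (J - {c})"
    unfolding set_det_def using K m(1) by simp
  then have "set_det f K J = (-1) ^ (m + q) * f k c * set_det f (K - {k}) (J - {c})"
    by (simp add: 1 cofactor_def)
  then show ?thesis unfolding m_def q_def .
qed

text \<open>The rows of \<open>X\<close> stacked on top of \<open>W\<^sub>0\<close>, with rows and columns indexed from 1.\<close>

definition stacked :: "nat \<Rightarrow> real mat \<Rightarrow> nat \<Rightarrow> nat \<Rightarrow> real" where
  "stacked n X k c = (if k \<le> n then X $$ (k - 1, c - 1)
     else if c + k = 2 * n + 1 then (-1) ^ (k - n + 1) else 0)"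

text \<open>The rows beyond \<open>n\<close> are split off from the largest downwards. The last
  hypothesis is the invariant: the columns already struck out lie to the left of the column paired
  with any remaining row beyond \<open>n\<close>.\<close>

lemma set_det_stacked:
  assumes "K \<subseteq> {1..2 * n}" "J \<subseteq> {1..n}" "card K = card J"
    and "\<And>c k. c \<in> {1..n} - J \<Longrightarrow> k \<in> K \<Longrightarrow> n < k \<Longrightarrow> c + k < 2 * n + 1"
  shows "set_det (stacked n X) K J = set_det (\<lambda>i j. X $$ (i - 1, j - 1)) (K \<inter> {1..n})
    (J - (\<lambda>k. 2 * n + 1 - k) ` {k \<in> K. k \<ge> n + 1})"
  using assms
proof (induction "card {k \<in> K. n < k}" arbitrary: K J)
  case 0
  have fin: "finite K" using 0 finite_subset by blast
  then have e: "{k \<in> K. n < k} = {}" using 0(1) by simp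
  then have K: "K \<subseteq> {1..n}" using 0(2) by force
  then have eqs: "K \<inter> {1..n} = K" "{k \<in> K. k \<ge> n + 1} = {}" using e by auto
  have "pick K i \<le> n" if "i < card K" for i
    using pick_in_set[of i K] that K by auto
  then show ?case
    unfolding eqs set_det_def image_empty Diff_empty by (intro detf_cong) (simp add: stacked_def)
next
  case (Suc s)
  have fin: "finite K" "finite J" using Suc.prems finite_subset by blast+
  define k where "k = Max K"
  have "K \<noteq> {}" using Suc(2) by auto
  then have k: "k \<in> K" "\<And>l. l \<in> K \<Longrightarrow> l \<le> k" using fin by (simp_all add: k_def)
  obtain l where "l \<in> K" "n < l"
    using Suc(2) by (metis (mono_tags, lifting) card.empty empty_Collect_eq nat.distinct(1))
  then have nk: "n < k" using k(2)[of l] by simp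
  have k2: "k \<le> 2 * n" using Suc.prems(1) k by auto
  define c where "c = 2 * n + 1 - k"
  have c: "c \<in> {1..n}" "c + k = 2 * n + 1" using nk k2 by (auto simp: c_def)
  have cJ: "c \<in> J"
  proof (rule ccontr)
    assume "c \<notin> J"
    then have "c + k < 2 * n + 1" using Suc.prems(4)[of c k] c k nk by auto
    then show False using c by simp
  qed
  \<comment> \<open>The columns missing from \<open>J\<close> all lie to the left of
    \<open>c\<close>, which gives the position of \<open>c\<close> in \<open>J\<close>. As
    \<open>c + k = 2 * n + 1\<close>, the sign of the expansion and that of the entry have total
    exponent \<open>2 * card K\<close>; the alternating signs in \<open>stacked\<close> are made for
    this.\<close>
  have "card {j \<in> J. j < c} + (n - card J) = c - 1"
  proof -
    have "{j \<in> J. j < c} \<union> ({1..n} - J) = {1..<c}"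
      using Suc.prems(2) Suc.prems(4)[OF _ k(1) nk] c by fastforce
    moreover have "card ({j \<in> J. j < c} \<union> ({1..n} - J)) = card {j \<in> J. j < c} + card ({1..n} - J)"
      by (rule card_Un_disjoint) (use fin in auto)
    moreover have "card ({1..n} - J) = n - card J"
      using fin Suc.prems(2) by (simp add: card_Diff_subset)
    ultimately show ?thesis by simp
  qed
  moreover have "card J \<le> n" using card_mono[OF _ Suc.prems(2)] by simp
  moreover have "card J \<ge> 1" using cJ fin by (simp add: card_gt_0_iff Suc_le_eq) blast
  ultimately have "even (card K - 1 + card {j \<in> J. j < c} + (k - n + 1))"
    using Suc.prems(3) c nk k2 by presburger
  then have sign: "(-1) ^ (card K - 1 + card {j \<in> J. j < c}) * stacked n X k c = 1"
    using c nk by (simp add: stacked_def flip: power_add)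
  let ?K = "K - {k}" and ?J = "J - {c}"
  have "set_det (stacked n X) K J =
      (-1) ^ (card K - 1 + card {j \<in> J. j < c}) * stacked n X k c * set_det (stacked n X) ?K ?J"
    by (rule set_det_remove_Max) (use fin k cJ Suc.prems(3) nk c in \<open>auto simp: stacked_def\<close>)
  also have "\<dots> = set_det (stacked n X) ?K ?J" by (simp only: sign mult_1_left)
  also have "\<dots> = set_det (\<lambda>i j. X $$ (i - 1, j - 1)) (?K \<inter> {1..n})
    (?J - (\<lambda>k. 2 * n + 1 - k) ` {k \<in> ?K. k \<ge> n + 1})"
  proof (rule Suc.hyps(1))
    have "{l \<in> ?K. n < l} = {l \<in> K. n < l} - {k}" by auto
    then show "s = card {l \<in> ?K. n < l}" using Suc.hyps(2) k nk fin by simp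
    show "card ?K = card ?J" using k cJ fin Suc.prems(3) by simp
    fix c' k' assume *: "c' \<in> {1..n} - ?J" "k' \<in> ?K" "n < k'"
    show "c' + k' < 2 * n + 1"
    proof (cases "c' = c")
      case True
      then show ?thesis using * k(2)[of k'] c by auto
    next
      case False
      then show ?thesis using * Suc.prems(4)[of c' k'] by auto
    qed
  qed (use Suc.prems in auto)
  also have "?K \<inter> {1..n} = K \<inter> {1..n}" using nk by auto
  also have "?J - (\<lambda>k. 2 * n + 1 - k) ` {k \<in> ?K. k \<ge> n + 1} = J - (\<lambda>k. 2 * n + 1 - k) ` {k \<in> K. k \<ge> n + 1}"
  proof -
    have "{k \<in> K. k \<ge> n + 1} = insert k {k \<in> ?K. k \<ge> n + 1}" using k nk by auto
    then show ?thesis by (auto simp: c_def)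
  qed
  finally show ?case .
qed

lemma pick_vimage_Suc:
  assumes "I \<subseteq> {1..n}" "i < card I"
  shows "pick I i = Suc (pick (Suc -` I) i)"
proof -
  note c = card_vimage_Suc[OF assms(1)]
  define S where "S = Suc -` I"
  define x where "x = pick S i"
  have S: "i < card S" "Suc ` S = I" using c assms(2) by (simp_all add: S_def)
  have x: "x \<in> S" "card {a \<in> S. a < x} = i"
    unfolding x_def using S(1) by (simp_all add: pick_in_set card_pick)
  have "{a \<in> Suc ` S. a < Suc x} = Suc ` {a \<in> S. a < x}" by auto
  then have "card {a \<in> I. a < Suc x} = i" using x(2) by (simp add: S(2) card_image)
  moreover have "Suc x \<in> I" using x(1) S(2) by blast
  ultimately have "pick I i = Suc x" using pick_card_in_set[of "Suc x" I] by simp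
  then show ?thesis by (simp only: x_def S_def)
qed

lemma minor_eq_set_det:
  assumes "X \<in> carrier_mat n n" "I \<subseteq> {1..n}" "J \<subseteq> {1..n}" "card I = card J"
  shows "minor X I J = set_det (\<lambda>i j. X $$ (i - 1, j - 1)) I J"
  unfolding minor_eq_detf[OF assms] set_det_def
proof (rule detf_cong)
  fix i j assume "i < card I" "j < card I"
  then have "pick I i = Suc (pick (Suc -` I) i)" "pick J j = Suc (pick (Suc -` J) j)"
    using pick_vimage_Suc assms by auto
  then show "X $$ (pick (Suc -` I) i, pick (Suc -` J) j) = X $$ (pick I i - 1, pick J j - 1)"
    by simp
qed

lemma sorted_list_of_set_pick:
  assumes "finite K"
  shows "sorted_list_of_set K = map (pick K) [0..<card K]"
proof -
  have "sorted_wrt (<) (map (pick K) [0..<card K])"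
    by (auto simp: sorted_wrt_map sorted_wrt_iff_nth_less intro: pick_strict_mono)
  moreover have "set (map (pick K) [0..<card K]) = K"
    using bij_betw_imp_surj_on[OF bij_betw_pick[OF assms]] by (simp add: atLeast0LessThan)
  ultimately show ?thesis
    using sorted_list_of_set_unique[OF assms, of "map (pick K) [0..<card K]"] by simp
qed

text \<open>On the full column set \<open>{1..n}\<close> the invariant of
  \<open>set_det_stacked\<close> is vacuous. The sorted list of rows is the form to which
  \<open>three_term_relation\<close> applies.\<close>

lemma plucker_eq_row_det:
  assumes X: "X \<in> carrier_mat n n" and K: "K \<in> plucker_indices n"
  shows "plucker n X K = row_det (map (\<lambda>k j. stacked n X k (Suc j)) (sorted_list_of_set K))"
proof -
  have K': "K \<subseteq> {1..2 * n}" "card K = n" "finite K"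
    using K finite_subset by (auto simp: plucker_indices_def)
  have p1: "pick {1..n} j = Suc j" if "j < n" for j
  proof -
    have "{a \<in> {1..n}. a < Suc j} = {1..j}" using that by auto
    then show ?thesis using pick_card_in_set[of "Suc j" "{1..n}"] that by simp
  qed
  have "plucker n X K = set_det (\<lambda>i j. X $$ (i - 1, j - 1)) (plucker_rows n K) (plucker_cols n K)"
    unfolding plucker_eq_minor
    by (rule minor_eq_set_det[OF X _ _ card_plucker_rows_cols[OF K]])
      (simp_all add: plucker_rows_def plucker_cols_def)
  also have "\<dots> = set_det (stacked n X) K {1..n}"
    unfolding plucker_rows_def plucker_cols_def
    by (rule set_det_stacked[symmetric, OF K'(1) order.refl]) (simp_all add: K'(2))
  also have "\<dots> = detf n (\<lambda>i j. stacked n X (pick K i) (Suc j))"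
    unfolding set_det_def K'(2) by (rule detf_cong) (simp only: p1)
  also have "\<dots> = row_det (map (\<lambda>k j. stacked n X k (Suc j)) (sorted_list_of_set K))"
    unfolding sorted_list_of_set_pick[OF K'(3)] K'(2) row_det_map ..
  finally show ?thesis .
qed

section \<open>Bounded ratios and the dimension of the cones\<close>

text \<open>Positivity supplies the nonvanishing that \<open>three_term_relation\<close> assumes,
  and will turn the relation into an inequality.\<close>

lemma plucker_three_term:
  fixes n :: nat and X :: "real mat" and D :: "nat set"
  defines "p \<equiv> \<lambda>x y. plucker n X ({x, y} \<union> D)"
  assumes X: "totally_positive n X"
    and D: "D \<subseteq> {1..2 * n}" "card D + 2 = n" "{a, b, c, d} \<inter> D = {}"
    and ord: "1 \<le> a" "a < b" "b < c" "c < d" "d \<le> 2 * n"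
  shows "p a b * p c d + p a d * p b c = p a c * p b d"
    and "\<And>x y. x \<in> {a, b, c, d} \<Longrightarrow> y \<in> {a, b, c, d} \<Longrightarrow> x \<noteq> y \<Longrightarrow> p x y > 0"
proof -
  have fin: "finite D" using D(1) by (rule finite_subset) simp
  have P: "{x, y} \<union> D \<in> plucker_indices n" if "x \<in> {a, b, c, d}" "y \<in> {a, b, c, d}" "x \<noteq> y" for x y
  proof -
    have "x \<in> {1..2 * n}" "y \<in> {1..2 * n}" using that(1,2) ord by auto
    moreover have "x \<notin> D" "y \<notin> D" using that(1,2) D(3) by auto
    ultimately show ?thesis using that(3) D fin by (simp add: plucker_indices_def)
  qed
  show pos: "p x y > 0" if "x \<in> {a, b, c, d}" "y \<in> {a, b, c, d}" "x \<noteq> y" for x y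
    unfolding p_def using plucker_pos[OF X P[OF that]] .
  have carr: "X \<in> carrier_mat n n" using X by (simp add: totally_positive_def)
  have p: "p x y = row_det (map (\<lambda>k j. stacked n X k (Suc j)) (sorted_list_of_set ({x, y} \<union> D)))"
    if "x \<in> {a, b, c, d}" "y \<in> {a, b, c, d}" "x \<noteq> y" for x y
    unfolding p_def by (rule plucker_eq_row_det[OF carr P[OF that]])
  have "p a b \<noteq> 0" using pos[of a b] ord by simp
  then show "p a b * p c d + p a d * p b c = p a c * p b d"
    using three_term_relation[OF fin D(3) ord(2-4), of "\<lambda>k j. stacked n X k (Suc j)"] ord
    by (simp add: p)
qed

section \<open>Values of ratios and boundedness of the primitive ones\<close>

lemma ratio_value_add:
  assumes "totally_positive n X"
  shows "ratio_value n (\<alpha> + \<beta>) X = ratio_value n \<alpha> X * ratio_value n \<beta> X"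
    and "ratio_value n (\<alpha> - \<beta>) X = ratio_value n \<alpha> X / ratio_value n \<beta> X"
proof -
  have "plucker n X K \<noteq> 0" if "K \<in> plucker_indices n" for K
    using plucker_pos[OF assms that] by simp
  then show "ratio_value n (\<alpha> + \<beta>) X = ratio_value n \<alpha> X * ratio_value n \<beta> X"
    and "ratio_value n (\<alpha> - \<beta>) X = ratio_value n \<alpha> X / ratio_value n \<beta> X"
    unfolding ratio_value_def prod.distrib[symmetric] prod_dividef[symmetric]
    by (auto simp: lookup_add lookup_minus power_int_add power_int_diff intro!: prod.cong)
qed

lemma ratio_value_single:
  assumes "K \<in> plucker_indices n"
  shows "ratio_value n (Poly_Mapping.single K 1) X = plucker n X K"
proof -
  have "ratio_value n (Poly_Mapping.single K 1) X
      = (\<Prod>L\<in>plucker_indices n. if L = K then plucker n X L else 1)"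
    unfolding ratio_value_def by (rule prod.cong) (auto simp: lookup_single when_def)
  also have "\<dots> = plucker n X K" using assms by (simp add: prod.delta)
  finally show ?thesis .
qed

lemma is_ratio_primitive:
  assumes "primitive_index n i j D"
  shows "is_ratio n (primitive_ratio n i j D)"
proof -
  have P: "{a, b} \<union> D \<in> plucker_indices n" if "a \<in> {i, i + 1}" "b \<in> {j, cyclic_succ n j}" for a b
    by (rule primitive_index_plucker[OF assms that])
  let ?s = "\<lambda>K. Poly_Mapping.single K (1::int)"
  have sum: "(\<Sum>L\<in>plucker_indices n. Poly_Mapping.lookup (?s K) L) = 1" if "K \<in> plucker_indices n" for K
    using that by (simp add: lookup_single when_def sum.delta)
  have "K \<in> plucker_indices n" if "K \<in> Poly_Mapping.keys (primitive_ratio n i j D)" for K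
  proof (rule ccontr)
    assume "K \<notin> plucker_indices n"
    then have "Poly_Mapping.lookup (?s ({a, b} \<union> D)) K = 0"
      if "a \<in> {i, i + 1}" "b \<in> {j, cyclic_succ n j}" for a b
      using P[OF that] by (intro lookup_single_not_eq) blast
    then have "Poly_Mapping.lookup (primitive_ratio n i j D) K = 0"
      by (simp add: primitive_ratio_def lookup_add lookup_minus)
    then show False using that by (simp add: in_keys_iff)
  qed
  moreover have "(\<Sum>L\<in>plucker_indices n. Poly_Mapping.lookup (primitive_ratio n i j D) L) = 0"
    unfolding primitive_ratio_def lookup_add lookup_minus sum.distrib sum_subtractf
    using sum[OF P, of i j] sum[OF P, of "i + 1" j] sum[OF P, of i "cyclic_succ n j"]
      sum[OF P, of "i + 1" "cyclic_succ n j"]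
    by simp
  ultimately show ?thesis unfolding is_ratio_def by blast
qed

text \<open>In the three-term relation of the four indices the numerator is one summand on the left
  and the denominator is the right side; the other summand is positive.\<close>

lemma bounded_ratio_primitive:
  assumes idx: "primitive_index n i j D"
  shows "bounded_ratio n (primitive_ratio n i j D)"
proof -
  have "ratio_value n (primitive_ratio n i j D) X \<le> 1" if X: "totally_positive n X" for X
  proof -
    define p where "p x y = plucker n X ({x, y} \<union> D)" for x y
    have comm: "p x y = p y x" for x y by (simp add: p_def insert_commute)
    have P: "{a, b} \<union> D \<in> plucker_indices n" if "a \<in> {i, i + 1}" "b \<in> {j, cyclic_succ n j}" for a b
      by (rule primitive_index_plucker[OF idx that])
    have val: "ratio_value n (primitive_ratio n i j D) X =
      p i (cyclic_succ n j) * p (i + 1) j / p i j / p (i + 1) (cyclic_succ n j)"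
      unfolding primitive_ratio_def ratio_value_add[OF X] p_def
      by (simp only: ratio_value_single P insertI1 insertI2 divide_divide_eq_left)
    have D: "D \<subseteq> {1..2 * n}" "card D + 2 = n" "{i, i + 1, j, cyclic_succ n j} \<inter> D = {}"
      and ij: "1 \<le> i" "i < j" "j \<le> 2 * n" "i + 1 \<noteq> j" "i \<noteq> cyclic_succ n j"
      using idx unfolding primitive_index_def by simp_all
    have le: "u / v / w \<le> 1" if "v > 0" "w > 0" "u \<le> v * w" for u v w :: real
      using that by (simp add: field_simps)
    show ?thesis
    proof (cases "j = 2 * n")
      case False
      then have s: "cyclic_succ n j = j + 1" by (simp add: cyclic_succ_def)
      have D': "{i, i + 1, j, j + 1} \<inter> D = {}" using D(3) s by simp
      have o: "1 \<le> i" "i < i + 1" "i + 1 < j" "j < j + 1" "j + 1 \<le> 2 * n" using ij False by auto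
      note rel = plucker_three_term(1)[OF X D(1,2) D' o, folded p_def]
      note pos = plucker_three_term(2)[OF X D(1,2) D' o, folded p_def]
      have "p i (i + 1) > 0" "p j (j + 1) > 0" "p i j > 0" "p (i + 1) (j + 1) > 0"
        using o by (auto intro!: pos)
      moreover have "p i (j + 1) * p (i + 1) j \<le> p i j * p (i + 1) (j + 1)"
        using rel mult_pos_pos[OF calculation(1,2)] by linarith
      ultimately show ?thesis unfolding val s by (intro le)
    next
      \<comment> \<open>The successor of \<open>2 * n\<close> is 1, so the increasing order is
        \<open>1\<close>, \<open>i\<close>, \<open>i + 1\<close>, \<open>j\<close>, and the
        numerator is now the first summand instead of the second.\<close>
      case True
      then have s: "cyclic_succ n j = 1" by (simp add: cyclic_succ_def)
      have D': "{1, i, i + 1, j} \<inter> D = {}" using D(3) s by auto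
      have o: "1 \<le> (1::nat)" "1 < i" "i < i + 1" "i + 1 < j" "j \<le> 2 * n" using ij s by auto
      note rel = plucker_three_term(1)[OF X D(1,2) D' o, folded p_def]
      note pos = plucker_three_term(2)[OF X D(1,2) D' o, folded p_def]
      have "p 1 j > 0" "p i (i + 1) > 0" "p i j > 0" "p 1 (i + 1) > 0"
        using o by (auto intro!: pos)
      moreover have "p 1 i * p (i + 1) j \<le> p i j * p 1 (i + 1)"
        using rel mult_pos_pos[OF calculation(1,2)] by (simp only: mult.commute)
      ultimately show ?thesis
        unfolding val s comm[of i 1] comm[of "i + 1" 1] by (intro le)
    qed
  qed
  then show ?thesis using is_ratio_primitive[OF idx] unfolding bounded_ratio_def by blast
qed

text \<open>The hull lies between \<open>S\<close> and \<open>span S\<close>.\<close>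

lemma dim_convex_cone_hull: "dim (convex_cone hull S) = dim S"
proof -
  have "convex_cone hull S \<subseteq> span S"
    by (intro hull_minimal span_superset subspace_imp_convex_cone subspace_span)
  moreover have "S \<subseteq> convex_cone hull S" by (rule hull_subset)
  ultimately have "span (convex_cone hull S) = span S"
    by (metis span_mono span_span subset_antisym)
  then show ?thesis by (metis dim_span)
qed

text \<open>An infinite basis has \<open>card\<close> 0, so \<open>dim\<close> is monotone only
  inside a finite-dimensional space, here \<open>span E\<close>.\<close>

lemma dim_le_if_subset_span_finite:
  fixes S T :: "'v::real_vector set"
  assumes "S \<subseteq> T" "T \<subseteq> span E" "finite E"
  shows "dim S \<le> dim T"
proof -
  obtain B where B: "B \<subseteq> S" "independent B" "card B = dim S"
    using basis_exists by metis
  obtain C where C: "C \<subseteq> T" "independent C" "T \<subseteq> span C" "card C = dim T"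
    using basis_exists by metis
  have "finite C"
    using independent_span_bound[OF assms(3) C(2) subset_trans[OF C(1) assms(2)]] by simp
  then show ?thesis
    using independent_span_bound[OF _ B(2), of C] B(1,3) assms(1) C(3,4) by auto
qed

lemma bounded_ratio_vectors_in_span:
  "ratio_vector ` {\<alpha>. bounded_ratio n \<alpha>} \<subseteq> span (unit_vector ` plucker_indices n)"
proof (rule image_subsetI)
  fix \<alpha> assume "\<alpha> \<in> {\<alpha>. bounded_ratio n \<alpha>}"
  then have "Poly_Mapping.keys (ratio_vector \<alpha>) \<subseteq> plucker_indices n"
    by (auto simp: bounded_ratio_def is_ratio_def in_keys_iff lookup_ratio_vector subset_iff)
  then show "ratio_vector \<alpha> \<in> span (unit_vector ` plucker_indices n)"
    by (rule in_span_single[OF finite_plucker_indices])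
qed

theorem theorem4p2:
  fixes n :: nat
  assumes "n \<ge> 1"
  shows "dim (primitive_cone n) = dim (bounded_cone n) \<and>
         int (dim (bounded_cone n)) = int ((2 * n) choose n) - 2 * int n"
proof -
  let ?R = "ratio_vector ` {\<alpha>. bounded_ratio n \<alpha>}"
  have "(2 * n) choose n \<le> dim (primitive_cone n) + 2 * n"
    using card_plucker_le_dim_primitive[OF assms]
    by (simp only: primitive_cone_def dim_convex_cone_hull card_plucker_indices)
  moreover have "dim (primitive_cone n) \<le> dim (bounded_cone n)"
    unfolding primitive_cone_def bounded_cone_def dim_convex_cone_hull
    by (rule dim_le_if_subset_span_finite[OF _ bounded_ratio_vectors_in_span])
      (auto intro: bounded_ratio_primitive)
  moreover have "dim (bounded_cone n) + 2 * n \<le> (2 * n) choose n"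
  proof -
    have "incidence n k v = 0" if v: "v \<in> ?R" and k: "k \<in> {1..2 * n}" for v k
    proof -
      from v obtain \<alpha> where "bounded_ratio n \<alpha>" "v = ratio_vector \<alpha>" by blast
      then show ?thesis
        using bounded_ratio_incidence[of n \<alpha> k] k
        by (simp add: incidence_def lookup_ratio_vector flip: of_int_sum)
    qed
    then show ?thesis
      unfolding bounded_cone_def dim_convex_cone_hull card_plucker_indices[symmetric]
      by (intro dim_incidence_kernel_le[OF assms bounded_ratio_vectors_in_span])
  qed
  \<comment> \<open>The three inequalities form a closed chain, so equality holds
    throughout.\<close>
  ultimately show ?thesis by linarith
qed

end
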